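(* Let $T$ be an Ammann--Beenker tiling. The smallest number of colours in a proper face colouring of $T$ is $2$. Moreover, a proper 2-colouring of the faces can be obtained by colouring the tiles based on their orientation, i.e. there is a proper face colouring of $T$ with two colours in which any two tiles that are translates of each other (for triangles: translates of each other together with their arrows) receive the same colour.
   Context: Ammann--Beenker substitution. Prototiles: a right isosceles triangle with sides $1,1,\sqrt2$ whose hypotenuse carries an arrow pointing from one of its endpoints (tail) to the other (head), and a rhombus of side $1$ with an angle of $45^\circ$. Let $\lambda=1+\sqrt2$, $h=\sqrt2/2$. The substitution $\omega$ expands by $\lambda$ and dissects as follows. (1) The triangle with vertices $(0,0),(\sqrt2,0),(h,h)$ and arrow from $(0,0)$ to $(\sqrt2,0)$: the expanded triangle with vertices $(0,0),(2+\sqrt2,0),(1+h,1+h)$ is dissected into the triangle $(0,0),(1,0),(1,1)$ with arrow from $(1,1)$ to $(0,0)$; the triangle $(1,0),(1+\sqrt2,0),(1+h,h)$ with arrow from $(1+\sqrt2,0)$ to $(1,0)$; the triangle $(1+h,h),(2+h,h),(1+h,1+h)$ with arrow from $(2+h,h)$ to $(1+h,1+h)$; the rhombus $(1,0),(1,1),(1+h,1+h),(1+h,h)$; and the rhombus $(1+\sqrt2,0),(2+\sqrt2,0),(2+h,h),(1+h,h)$. (2) The rhombus with vertices $(0,0),(1,0),(1+h,h),(h,h)$: the expanded rhombus with vertices $(0,0),(\lambda,0),(2+3h,1+h),(1+h,1+h)$ is dissected into the rhombus $(0,0),(1,0),(1+h,h),(h,h)$; the rhombus $(1+h,h),(\lambda,0),(\lambda,1),(1+h,1+h)$;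 the rhombus $(\lambda,1),(\lambda+1,1),(2+3h,1+h),(1+3h,1+h)$; the triangle $(h,h),(1+h,h),(1+h,1+h)$ with arrow from $(h,h)$ to $(1+h,1+h)$; the triangle $(1,0),(\lambda,0),(1+h,h)$ with arrow from $(1,0)$ to $(\lambda,0)$; the triangle $(\lambda,0),(\lambda,1),(\lambda+1,1)$ with arrow from $(\lambda+1,1)$ to $(\lambda,0)$; and the triangle $(\lambda,1),(1+h,1+h),(1+3h,1+h)$ with arrow from $(1+3h,1+h)$ to $(1+h,1+h)$. The rule is extended to all congruent copies (including reflections) of the prototiles, and to collections of tiles, covariantly. An Ammann--Beenker tiling is a tiling $T$ of $\mathbb{R}^2$ by congruent copies of the (arrowed) prototiles such that every finite set of tiles of $T$ is contained in a congruent copy of $\omega^n(p)$ for some $n\ge0$ and some prototile $p$. A proper face colouring is an assignment of colours to the tiles such that any two distinct tiles whose boundaries share a segment of positive length have different colours. *)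

theory Defs
  imports "HOL-Analysis.Analysis"
begin

(* The Euclidean plane is the type complex: Complex x y is the point (x, y). *)

definition isometry :: "(complex \<Rightarrow> complex) \<Rightarrow> bool" where
  "isometry f \<longleftrightarrow> (\<forall>x y. dist (f x) (f y) = dist x y)"

(* A tile is a closed region together with the arrow it carries, if any, given as
   (tail, head).  Vertices are not part of the data, so a rhombus has only one
   representation, whichever way its vertices are listed. *)
datatype tile = Tile (region: "complex set") (arrow: "(complex \<times> complex) option")

definition triangle :: "complex \<Rightarrow> complex \<Rightarrow> complex \<Rightarrow> tile" where
  "triangle tail head apex = Tile (convex hull {tail, head, apex}) (Some (tail, head))"

definition rhombus :: "complex \<Rightarrow> complex \<Rightarrow> complex \<Rightarrow> complex \<Rightarrow> tile" where
  "rhombus a b c d = Tile (convex hull {a, b, c, d}) None"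

definition move :: "(complex \<Rightarrow> complex) \<Rightarrow> tile \<Rightarrow> tile" where
  "move f t = Tile (f ` region t) (map_option (map_prod f f) (arrow t))"

datatype shape = Triangle | Rhombus

fun prototile :: "shape \<Rightarrow> tile" where
  "prototile Triangle =
     (let h = sqrt 2 / 2
      in triangle (Complex 0 0) (Complex (sqrt 2) 0) (Complex h h))"
| "prototile Rhombus =
     (let h = sqrt 2 / 2
      in rhombus (Complex 0 0) (Complex 1 0) (Complex (1 + h) h) (Complex h h))"

definition inflation :: real where
  "inflation = 1 + sqrt 2"

fun dissection :: "shape \<Rightarrow> tile set" where
  "dissection Triangle =
     (let h = sqrt 2 / 2 in
      {triangle (Complex 1 1) (Complex 0 0) (Complex 1 0),
       triangle (Complex (1 + sqrt 2) 0) (Complex 1 0) (Complex (1 + h) h),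
       triangle (Complex (2 + h) h) (Complex (1 + h) (1 + h)) (Complex (1 + h) h),
       rhombus (Complex 1 0) (Complex 1 1) (Complex (1 + h) (1 + h)) (Complex (1 + h) h),
       rhombus (Complex (1 + sqrt 2) 0) (Complex (2 + sqrt 2) 0)
               (Complex (2 + h) h) (Complex (1 + h) h)})"
| "dissection Rhombus =
     (let h = sqrt 2 / 2; l = inflation in
      {rhombus (Complex 0 0) (Complex 1 0) (Complex (1 + h) h) (Complex h h),
       rhombus (Complex (1 + h) h) (Complex l 0) (Complex l 1) (Complex (1 + h) (1 + h)),
       rhombus (Complex l 1) (Complex (l + 1) 1)
               (Complex (2 + 3 * h) (1 + h)) (Complex (1 + 3 * h) (1 + h)),
       triangle (Complex h h) (Complex (1 + h) (1 + h)) (Complex (1 + h) h),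
       triangle (Complex 1 0) (Complex l 0) (Complex (1 + h) h),
       triangle (Complex (l + 1) 1) (Complex l 0) (Complex l 1),
       triangle (Complex (1 + 3 * h) (1 + h)) (Complex (1 + h) (1 + h)) (Complex l 1)})"

definition congruent_copy :: "tile \<Rightarrow> bool" where
  "congruent_copy t \<longleftrightarrow> (\<exists>f p. isometry f \<and> t = move f (prototile p))"

(* Covariance: if f is an isometry with linear part A and translation part b, the image
   of the tile f(p) is obtained from the dissection of the expanded prototile by the
   isometry x |-> A x + inflation * b, that is, by f conjugated with the expansion.
   A rhombus is f(p) for four isometries f; as the dissection of the expanded rhombus is
   invariant under the symmetries of that rhombus, all four give the same set of tiles. *)
definition expand_isometry :: "(complex \<Rightarrow> complex) \<Rightarrow> complex \<Rightarrow> complex" where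
  "expand_isometry f x = inflation *\<^sub>R f (x /\<^sub>R inflation)"

definition subst_tile :: "tile \<Rightarrow> tile set" where
  "subst_tile t =
     \<Union> {move (expand_isometry f) ` dissection p | f p. isometry f \<and> t = move f (prototile p)}"

definition subst :: "tile set \<Rightarrow> tile set" where
  "subst P = (\<Union>t\<in>P. subst_tile t)"

definition tiling :: "tile set \<Rightarrow> bool" where
  "tiling T \<longleftrightarrow>
     (\<forall>t\<in>T. congruent_copy t) \<and>
     (\<Union>t\<in>T. region t) = UNIV \<and>
     (\<forall>s\<in>T. \<forall>t\<in>T. s \<noteq> t \<longrightarrow> interior (region s) \<inter> interior (region t) = {})"

definition ammann_beenker_tiling :: "tile set \<Rightarrow> bool" where
  "ammann_beenker_tiling T \<longleftrightarrow>
     tiling T \<and>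
     (\<forall>F. finite F \<and> F \<subseteq> T \<longrightarrow>
        (\<exists>n p f. isometry f \<and> F \<subseteq> move f ` ((subst ^^ n) {prototile p})))"

definition share_segment :: "tile \<Rightarrow> tile \<Rightarrow> bool" where
  "share_segment s t \<longleftrightarrow>
     (\<exists>a b. a \<noteq> b \<and> closed_segment a b \<subseteq> frontier (region s) \<inter> frontier (region t))"

definition proper_face_colouring :: "tile set \<Rightarrow> (tile \<Rightarrow> 'c) \<Rightarrow> bool" where
  "proper_face_colouring T c \<longleftrightarrow>
     (\<forall>s\<in>T. \<forall>t\<in>T. s \<noteq> t \<and> share_segment s t \<longrightarrow> c s \<noteq> c t)"

definition face_colourable :: "tile set \<Rightarrow> nat \<Rightarrow> bool" where
  "face_colourable T k \<longleftrightarrow>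
     (\<exists>c :: tile \<Rightarrow> nat. proper_face_colouring T c \<and> c ` T \<subseteq> {..<k})"

definition translates :: "tile \<Rightarrow> tile \<Rightarrow> bool" where
  "translates s t \<longleftrightarrow> (\<exists>v. t = move (\<lambda>x. x + v) s)"

end

theory Submission
  imports Defs
begin

text \<open>
  Direct the edges of a triangle cyclically (tail, head, apex) and those of a rhombus from its acute
  to its obtuse vertices. Inflation subdivides every edge into directed edges in a way that depends
  only on the directed edge, so by induction any two tiles of a supertile that share a segment share
  a whole edge, with the same direction, and lie on opposite sides of it. Give a tile on the left of
  a directed unit edge $v$ the value $v^4$, on the right $-v^4$, and use $\mp v^4 / 4$ for
  hypotenuses: all edges of a tile yield the same value, it depends only on the orientation of the
  tile, neighbouring tiles have opposite values, and within a supertile only two values occur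
  because all edge directions differ by multiples of $45^\circ$. Conversely one colour is not
  enough, since by local finiteness an edge of a tile meets some other tile in two points.
\<close>

section \<open>Isometries of the plane\<close>

text \<open>Directions matter because an inflated unit edge splits asymmetrically, into lengths
  \<open>1\<close> and \<open>sqrt 2\<close> in this order: two tiles along it are subdivided
  consistently only if both read it the same way round. The fourth power is what the edges of one
  tile demand. At an acute vertex of a rhombus the two outgoing edges enclose 45 degrees and have
  the tile on opposite sides, and a turn by 45 degrees changes the sign of \<open>v^4\<close>. The
  legs of a triangle differ by 90 degrees, which preserves \<open>v^4\<close>. The hypotenuse
  differs from them by an odd multiple of 45 degrees, which the minus sign repairs, and 4 is the
  fourth power of its length. Neighbours with different parents are the obstacle. The induction
  therefore treats all pairs of tiles of a supertile and includes that pairs without a common edge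
  meet in at most one point, which children inherit from their parents. A rhombus is the image of
  its prototile under four isometries, so the substitution and the value of a tile must be shown
  independent of that choice; this is where the stabilisers of the prototiles enter.\<close>

definition pose :: "real \<Rightarrow> complex \<Rightarrow> complex \<Rightarrow> complex \<Rightarrow> complex" where
  "pose e u c z = u * Complex (Re z) (e * Im z) + c"

text \<open>\<open>e\<close> is the determinant of the linear part. As a real sign it can multiply
  \<open>side\<close> and the value of a tile, and \<open>Complex (Re z) (e * Im z)\<close> is
  \<open>z\<close> or its conjugate without a case distinction.\<close>

definition frame :: "real \<Rightarrow> complex \<Rightarrow> bool" where
  "frame e u \<longleftrightarrow> (e = 1 \<or> e = -1) \<and> norm u = 1"

lemma frame_square: "frame e u \<Longrightarrow> e * e = 1"
  by (auto simp: frame_def)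

lemma pose_comp:
  assumes "frame e u"
  shows "pose e u c \<circ> pose e' u' c' = pose (e * e') (u * Complex (Re u') (e * Im u')) (pose e u c c')"
  using assms
  by (auto simp: fun_eq_iff pose_def complex_eq_iff frame_def algebra_simps)

lemma norm_Complex_sign: "e = 1 \<or> e = -1 \<Longrightarrow> norm (Complex (Re z) (e * Im z)) = norm z"
  by (auto simp: cmod_def)

lemma frame_comp:
  assumes "frame e u" "frame e' u'"
  shows "frame (e * e') (u * Complex (Re u') (e * Im u'))"
  using assms norm_Complex_sign[of e u'] by (auto simp: frame_def norm_mult)

lemma pose_diff: "pose e u c x - pose e u c y = u * Complex (Re (x - y)) (e * Im (x - y))"
  by (simp add: pose_def complex_eq_iff algebra_simps)

lemma norm_pose_diff: "frame e u \<Longrightarrow> norm (pose e u c x - pose e u c y) = norm (x - y)"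
  unfolding pose_diff frame_def by (metis norm_Complex_sign norm_mult mult_1)

lemma isometry_pose: "frame e u \<Longrightarrow> isometry (pose e u c)"
  by (simp add: isometry_def dist_norm norm_pose_diff)

text \<open>Subtracting \<open>f 0\<close> leaves a norm-preserving map, also for differences; by
  polarisation it preserves inner products and is determined by the images of \<open>1\<close> and
  the imaginary unit.\<close>

lemma isometry_is_pose:
  assumes "isometry f"
  obtains e u c where "frame e u" "f = pose e u c"
proof -
  define g where "g z = f z - f 0" for z
  have d: "norm (g x - g y) = norm (x - y)" for x y
    using assms by (simp add: isometry_def g_def dist_norm)
  have g0: "g 0 = 0" by (simp add: g_def)
  have n: "norm (g x) = norm x" for x
    using d[of x 0] g0 by simp
  have ip: "g x \<bullet> g y = x \<bullet> y" for x y
    by (simp add: dot_norm_neg d n)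
  define u where "u = g 1"
  have u1: "Re u * Re u + Im u * Im u = 1"
    using ip[of 1 1] by (simp add: u_def inner_complex_def)
  have u2: "Re u * Re (g \<i>) + Im u * Im (g \<i>) = 0"
    using ip[of 1 \<i>] by (simp add: u_def inner_complex_def)
  have u3: "Re (g \<i>) * Re (g \<i>) + Im (g \<i>) * Im (g \<i>) = 1"
    using ip[of \<i> \<i>] by (simp add: inner_complex_def)
  \<comment> \<open>The determinant of the orthonormal pair of images, hence a sign.\<close>
  define e where "e = Re u * Im (g \<i>) - Im u * Re (g \<i>)"
  have "e * e = 1"
    using u1 u2 u3 unfolding e_def by algebra
  then have e: "e = 1 \<or> e = -1"
    using square_eq_1_iff by blast
  have gi: "Re (g \<i>) = - e * Im u" "Im (g \<i>) = e * Re u"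
    using u1 u2 unfolding e_def by algebra+
  have "f z = pose e u (f 0) z" for z
  proof -
    have 1: "Re u * Re (g z) + Im u * Im (g z) = Re z"
      using ip[of 1 z] by (simp add: u_def inner_complex_def)
    have 2: "- e * Im u * Re (g z) + e * Re u * Im (g z) = Im z"
      using ip[of \<i> z] by (simp add: gi inner_complex_def)
    have "Re (g z) = Re u * Re z - Im u * (e * Im z)"
      by (rule disjE[OF e]) (use 1 2 u1 in algebra)+
    moreover have "Im (g z) = Re u * (e * Im z) + Im u * Re z"
      by (rule disjE[OF e]) (use 1 2 u1 in algebra)+
    ultimately have "g z = u * Complex (Re z) (e * Im z)"
      by (simp add: complex_eq_iff)
    then show ?thesis by (simp add: pose_def g_def algebra_simps)
  qed
  moreover have "frame e u"
    using e u1 by (simp add: frame_def cmod_def power2_eq_square)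
  ultimately show ?thesis
    using that by blast
qed

text \<open>Conjugation with the expansion keeps the linear part and only scales the
  translation.\<close>

lemma expand_pose: "expand_isometry (pose e u c) = pose e u (inflation *\<^sub>R c)"
proof -
  have "inflation > 0" by (simp add: inflation_def add_pos_nonneg)
  then show ?thesis
    by (auto simp: fun_eq_iff expand_isometry_def pose_def complex_eq_iff field_simps)
qed

lemma pose_id: "pose 1 1 0 = id"
  by (simp add: fun_eq_iff pose_def complex_eq_iff)

text \<open>The inverse has the same sign \<open>e\<close>: for \<open>e = 1\<close> its rotation is
  the conjugate of \<open>u\<close>, for \<open>e = -1\<close> it is \<open>u\<close>
  itself.\<close>

lemma pose_inverse:
  assumes "frame e u"
  obtains u' c' where "frame e u'" "pose e u' c' \<circ> pose e u c = id" "pose e u c \<circ> pose e u' c' = id"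
proof -
  have n: "Re u * Re u + Im u * Im u = 1"
    using assms by (auto simp: frame_def cmod_def power2_eq_square)
  define u' where "u' = Complex (Re u) (- e * Im u)"
  define c' where "c' = - u' * Complex (Re c) (e * Im c)"
  have "frame e u'"
    using assms by (auto simp: u'_def frame_def cmod_def)
  moreover have "u' * Complex (Re u) (e * Im u) = 1" "u * Complex (Re u') (e * Im u') = 1"
    using assms n by (auto simp: u'_def complex_eq_iff frame_def algebra_simps)
  moreover have "pose e u' c' c = 0"
    by (simp add: pose_def c'_def)
  moreover have "pose e u c c' = 0"
  proof -
    have "Complex (Re c') (e * Im c') = - Complex (Re u') (e * Im u') * c"
      using assms by (auto simp: c'_def complex_eq_iff frame_def)
    then show ?thesis
      using \<open>u * Complex (Re u') (e * Im u') = 1\<close>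
      by (simp add: pose_def flip: mult.assoc)
  qed
  ultimately show ?thesis
    using that assms by (metis pose_comp frame_square pose_id)
qed

section \<open>Moving tiles\<close>

lemma move_move: "move f (move g t) = move (f \<circ> g) t"
  by (cases t) (auto simp: move_def image_comp option.map_comp map_prod_compose)

lemma move_id: "move id t = t"
  by (cases t) (simp add: move_def prod.map_id0 option.map_id0)

lemma inj_pose: "frame e u \<Longrightarrow> inj (pose e u c)"
  by (rule pose_inverse[of e u c]) (auto simp: fun_eq_iff intro: inj_on_inverseI)

lemma pose_hull: "pose e u c ` (convex hull S) = convex hull (pose e u c ` S)"
proof -
  define L where "L = (\<lambda>z. u * Complex (Re z) (e * Im z))"
  have "linear L"
    unfolding L_def by (rule linearI) (auto simp: complex_eq_iff algebra_simps)
  have p: "pose e u c ` A = (+) c ` L ` A" for A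
    by (auto simp: pose_def L_def image_image add.commute)
  show ?thesis
    unfolding p convex_hull_translation convex_hull_linear_image[OF \<open>linear L\<close>] ..
qed

lemma move_pose_triangle:
  "move (pose e u c) (triangle x y z) = triangle (pose e u c x) (pose e u c y) (pose e u c z)"
  by (simp add: move_def triangle_def pose_hull)

lemma move_pose_rhombus:
  "move (pose e u c) (rhombus x y z w) = rhombus (pose e u c x) (pose e u c y) (pose e u c z) (pose e u c w)"
  by (simp add: move_def rhombus_def pose_hull)

lemma region_triangle: "region (triangle x y z) = convex hull {x, y, z}"
  by (simp add: triangle_def)

lemma region_rhombus: "region (rhombus x y z w) = convex hull {x, y, z, w}"
  by (simp add: rhombus_def)

lemma region_move: "region (move f t) = f ` region t"
  by (simp add: move_def)

text \<open>A proper convex combination of two points of this set is strictly inside the half-plane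
  unless both lie on the boundary line, where convexity of \<open>F\<close> applies.\<close>

lemma convex_halfspace_with_face:
  fixes n :: complex
  assumes "convex F" "\<And>z. z \<in> F \<Longrightarrow> n \<bullet> z = c"
  shows "convex ({z. c < n \<bullet> z} \<union> F)"
proof (rule convexI)
  fix x y and u v :: real
  assume x: "x \<in> {z. c < n \<bullet> z} \<union> F" and y: "y \<in> {z. c < n \<bullet> z} \<union> F"
    and u: "0 \<le> u" "0 \<le> v" "u + v = 1"
  show "u *\<^sub>R x + v *\<^sub>R y \<in> {z. c < n \<bullet> z} \<union> F"
  proof (cases "x \<in> F \<and> y \<in> F \<or> u = 0 \<or> v = 0")
    case True
    then show ?thesis
      using x y u convexD[OF assms(1)] by auto
  next
    case False
    then have p: "0 < u" "0 < v" and "c < n \<bullet> x \<or> c < n \<bullet> y" "c \<le> n \<bullet> x" "c \<le> n \<bullet> y"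
      using x y u assms(2) by force+
    then have "u * c + v * c < u * (n \<bullet> x) + v * (n \<bullet> y)"
      by (meson add_le_less_mono add_less_le_mono mult_left_mono mult_strict_left_mono order_less_imp_le)
    then show ?thesis
      using u by (simp add: inner_add_right flip: distrib_right)
  qed
qed

text \<open>Reduces a claim about a whole hull to its vertices. \<open>F\<close> is a single point
  in \<open>hull_touches_once\<close> and a whole edge in \<open>proto_side\<close>.\<close>

lemma hull_meets_face:
  fixes n :: complex
  assumes "\<And>v. v \<in> S \<Longrightarrow> c < n \<bullet> v \<or> v \<in> F" "convex F" "\<And>z. z \<in> F \<Longrightarrow> n \<bullet> z = c"
    and "z \<in> convex hull S"
  shows "c < n \<bullet> z \<or> z \<in> F"
proof -
  have "convex hull S \<subseteq> {z. c < n \<bullet> z} \<union> F"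
    using assms by (intro hull_minimal convex_halfspace_with_face) auto
  then show ?thesis
    using assms(4) by blast
qed

lemma hull_touches_once:
  fixes n :: complex
  assumes "\<forall>v\<in>S. v = v0 \<or> 0 < n \<bullet> (v - v0)" "z \<in> convex hull S" "n \<bullet> (z - v0) \<le> 0"
  shows "z = v0"
proof -
  have "n \<bullet> v0 < n \<bullet> z \<or> z \<in> {v0}"
    by (rule hull_meets_face[of S]) (use assms(1,2) in \<open>auto simp: inner_diff_right\<close>)
  then show ?thesis
    using assms(3) by (simp add: inner_diff_right)
qed

lemma hull_le:
  fixes n :: complex
  assumes "\<forall>v\<in>S. n \<bullet> (v - v0) \<le> 0" "z \<in> convex hull S"
  shows "n \<bullet> (z - v0) \<le> 0"
proof -
  have "convex hull S \<subseteq> {z. n \<bullet> z \<le> n \<bullet> v0}"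
    using assms(1) by (intro hull_minimal) (auto simp: convex_halfspace_le inner_diff_right)
  then show ?thesis
    using assms(2) by (auto simp: inner_diff_right)
qed

section \<open>Directed edges of tiles\<close>

abbreviation hsq :: real where "hsq \<equiv> sqrt 2 / 2"

text \<open>
  All edges listed here have the prototile on their left. A single edge of the rhombus suffices:
  the symmetries of the rhombus carry it to the other three.
\<close>

fun proto_edges :: "shape \<Rightarrow> (complex \<times> complex) set" where
  "proto_edges Triangle =
     {(0, Complex (sqrt 2) 0), (Complex (sqrt 2) 0, Complex hsq hsq),
      (Complex hsq hsq, 0)}"
| "proto_edges Rhombus = {(0, 1)}"

text \<open>The last argument is $1$ if the tile lies to the left of the directed edge and $-1$ otherwise.\<close>

inductive has_edge :: "tile \<Rightarrow> complex \<Rightarrow> complex \<Rightarrow> real \<Rightarrow> bool" where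
  has_edge: "frame e u \<Longrightarrow> (a, b) \<in> proto_edges p \<Longrightarrow>
     has_edge (move (pose e u c) (prototile p)) (pose e u c a) (pose e u c b) e"

lemma has_edge_cases:
  assumes "has_edge t a b s"
  obtains u c p a0 b0 where "frame s u" "(a0, b0) \<in> proto_edges p" "t = move (pose s u c) (prototile p)"
    "a = pose s u c a0" "b = pose s u c b0"
  using assms by (auto elim: has_edge.cases)

lemma has_edge_sign: "has_edge t a b s \<Longrightarrow> s = 1 \<or> s = -1"
  by (auto elim!: has_edge_cases simp: frame_def)

lemma has_edge_move:
  assumes "frame e u" "has_edge t a b s"
  shows "has_edge (move (pose e u c) t) (pose e u c a) (pose e u c b) (e * s)"
  using assms(2)
proof (cases rule: has_edge_cases)
  case (1 u' c' p a0 b0)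
  then show ?thesis
    using has_edge[OF frame_comp[OF assms(1) 1(1)] 1(2), of "pose e u c c'"]
    by (simp add: move_move flip: pose_comp[OF assms(1)])
qed

text \<open>\<open>s\<close> is \<open>1\<close> if the apex lies to the left of the arrow. The
  complex factor turns by 45 degrees and shrinks the hypotenuse to a leg; the length is stated in
  coordinates so that simplification can check concrete vertices.\<close>

definition right_isosceles :: "real \<Rightarrow> complex \<Rightarrow> complex \<Rightarrow> complex \<Rightarrow> bool" where
  "right_isosceles s t h x \<longleftrightarrow> (s = 1 \<or> s = -1) \<and> (Re h - Re t)\<^sup>2 + (Im h - Im t)\<^sup>2 = 2 \<and>
     x = t + (h - t) * Complex (1 / 2) (s / 2)"

text \<open>\<open>a\<close> and \<open>c\<close> are the acute vertices; \<open>d\<close> arises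
  from \<open>b\<close> by a turn about \<open>a\<close> through \<open>s\<close> times 45 degrees,
  so the rhombus lies on side \<open>s\<close> of the edge from \<open>a\<close> to
  \<open>b\<close>.\<close>

definition unit_rhombus :: "real \<Rightarrow> complex \<Rightarrow> complex \<Rightarrow> complex \<Rightarrow> complex \<Rightarrow> bool" where
  "unit_rhombus s a b c d \<longleftrightarrow> (s = 1 \<or> s = -1) \<and> (Re b - Re a)\<^sup>2 + (Im b - Im a)\<^sup>2 = 1 \<and>
     d = a + (b - a) * Complex hsq (s * hsq) \<and> c = b + d - a"

lemma triangle_edges:
  assumes "right_isosceles s t h x"
  shows "has_edge (triangle t h x) t h s" "has_edge (triangle t h x) h x s"
    "has_edge (triangle t h x) x t s"
proof -
  define u where "u = (h - t) / complex_of_real (sqrt 2)"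
  have "frame s u"
    using assms
    by (auto simp: right_isosceles_def frame_def u_def norm_divide cmod_def power_divide
        simp flip: add_divide_distrib)
  have h: "h = t + complex_of_real (sqrt 2) * u"
    by (simp add: u_def)
  have p: "pose s u t 0 = t" "pose s u t (Complex (sqrt 2) 0) = h"
    "pose s u t (Complex hsq hsq) = x"
    using assms
    by (auto simp: right_isosceles_def pose_def h complex_eq_iff algebra_simps)
  have t: "triangle t h x = move (pose s u t) (prototile Triangle)"
    using p by (simp add: Let_def move_pose_triangle zero_complex.ctr)
  show "has_edge (triangle t h x) t h s" "has_edge (triangle t h x) h x s"
    "has_edge (triangle t h x) x t s"
    using has_edge[OF \<open>frame s u\<close>, of 0 "Complex (sqrt 2) 0" Triangle t]
      has_edge[OF \<open>frame s u\<close>, of "Complex (sqrt 2) 0" "Complex hsq hsq" Triangle t]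
      has_edge[OF \<open>frame s u\<close>, of "Complex hsq hsq" 0 Triangle t]
    unfolding t[symmetric] p by simp_all
qed

text \<open>Listing the vertices in the other sense amounts to a reflection in the diagonal through
  \<open>a\<close> and \<open>c\<close>, which changes the sign; starting from \<open>c\<close>
  amounts to a half turn. Together they reach all four edges.\<close>

lemma unit_rhombus_sym:
  assumes "unit_rhombus s a b c d"
  shows "unit_rhombus (-s) a d c b" "unit_rhombus s c d a b"
proof -
  define k where "k = Complex hsq (s * hsq)"
  define k' where "k' = Complex hsq (- s * hsq)"
  have s: "s = 1 \<or> s = -1" and ab: "(norm (b - a))\<^sup>2 = 1" and d: "d = a + (b - a) * k" and c: "c = b + d - a"
    using assms by (auto simp: unit_rhombus_def k_def cmod_power2)
  have "k * k' = 1" "norm k = 1"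
    using s by (auto simp: k_def k'_def complex_eq_iff cmod_def power2_eq_square)
  then have "b = a + (d - a) * k'" "(norm (d - a))\<^sup>2 = 1"
    using d ab by (simp_all add: norm_mult mult.assoc)
  then show "unit_rhombus (-s) a d c b"
    using s c by (auto simp: unit_rhombus_def k'_def cmod_power2)
  have "(norm (d - c))\<^sup>2 = 1"
    using c ab by (simp add: norm_minus_commute)
  moreover have "b = c + (d - c) * k"
  proof -
    have "c + (d - c) * k = b + (d - a) + (a - b) * k"
      unfolding c by (simp add: algebra_simps)
    also have "d - a = (b - a) * k"
      using d by simp
    finally show ?thesis
      by (simp add: algebra_simps)
  qed
  moreover have "a = d + b - c"
    using c by simp
  ultimately show "unit_rhombus s c d a b"
    using s unfolding unit_rhombus_def k_def[symmetric] cmod_power2 minus_complex.sel by blast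
qed

lemma rhombus_sym: "rhombus a d c b = rhombus a b c d" "rhombus c d a b = rhombus a b c d"
  "rhombus b c d a = rhombus a b c d"
  by (simp_all add: rhombus_def insert_commute)

lemma rhombus_edge:
  assumes "unit_rhombus s a b c d"
  shows "has_edge (rhombus a b c d) a b s"
proof -
  define u where "u = b - a"
  have "frame s u"
    using assms
    by (auto simp: unit_rhombus_def frame_def u_def cmod_def)
  have p: "pose s u a 0 = a" "pose s u a 1 = b"
    "pose s u a (Complex hsq hsq) = d"
    "pose s u a (Complex (1 + hsq) hsq) = c"
    using assms
    by (auto simp: unit_rhombus_def pose_def u_def complex_eq_iff algebra_simps)
  have "rhombus a b c d = move (pose s u a) (prototile Rhombus)"
    using p by (simp add: Let_def move_pose_rhombus zero_complex.ctr one_complex.ctr)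
  then show ?thesis
    using has_edge[OF \<open>frame s u\<close>, of 0 1 Rhombus a] p by simp
qed

lemma rhombus_edges:
  assumes "unit_rhombus s a b c d"
  shows "has_edge (rhombus a b c d) a b s" "has_edge (rhombus a b c d) a d (- s)"
    "has_edge (rhombus a b c d) c b (- s)" "has_edge (rhombus a b c d) c d s"
  using rhombus_edge[OF assms] rhombus_edge[OF unit_rhombus_sym(1)[OF assms]]
    rhombus_edge[OF unit_rhombus_sym(2)[OF assms]]
    rhombus_edge[OF unit_rhombus_sym(1)[OF unit_rhombus_sym(2)[OF assms]]]
  by (simp_all add: rhombus_sym)

text \<open>Twice the signed area of the triangle \<open>a\<close>, \<open>b\<close>,
  \<open>z\<close>: positive to the left of the directed edge.\<close>

definition side :: "complex \<Rightarrow> complex \<Rightarrow> complex \<Rightarrow> real" where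
  "side a b z = (\<i> * (b - a)) \<bullet> (z - a)"

lemma side_pose:
  assumes "frame e u"
  shows "side (pose e u c a) (pose e u c b) (pose e u c z) = e * side a b z"
proof -
  have "Re u * Re u + Im u * Im u = 1" "e * e = 1"
    using assms by (auto simp: frame_def cmod_def power2_eq_square)
  then show ?thesis
    unfolding side_def pose_diff by (simp add: inner_complex_def) algebra
qed

lemma proto_side:
  assumes "(a, b) \<in> proto_edges p" "z \<in> region (prototile p)"
  shows "0 < side a b z \<or> z \<in> closed_segment a b"
proof -
  define S where "S = (case p of Triangle \<Rightarrow> {0, Complex (sqrt 2) 0, Complex hsq hsq}
    | Rhombus \<Rightarrow> {0, 1, Complex (1 + hsq) hsq, Complex hsq hsq})"
  have z: "z \<in> convex hull S"
    using assms(2)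
    by (cases p) (simp_all add: S_def Let_def region_triangle region_rhombus zero_complex.ctr one_complex.ctr)
  have "(\<i> * (b - a)) \<bullet> a < (\<i> * (b - a)) \<bullet> z \<or> z \<in> closed_segment a b"
  proof (rule hull_meets_face[OF _ _ _ z])
    show "(\<i> * (b - a)) \<bullet> a < (\<i> * (b - a)) \<bullet> v \<or> v \<in> closed_segment a b" if "v \<in> S" for v
      using assms(1) that
      by (cases p) (auto simp: S_def inner_complex_def)
    show "(\<i> * (b - a)) \<bullet> v = (\<i> * (b - a)) \<bullet> a" if v: "v \<in> closed_segment a b" for v
    proof -
      obtain x where x: "v = (1 - x) *\<^sub>R a + x *\<^sub>R b"
        using v unfolding closed_segment_def by blast
      show ?thesis
        unfolding x by (simp add: inner_complex_def algebra_simps)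
    qed
  qed simp
  then show ?thesis
    by (simp add: side_def inner_diff_right)
qed

text \<open>Consequently two tiles with the same directed edge and opposite signs can only meet
  inside that edge.\<close>

lemma has_edge_side:
  assumes "has_edge t a b s" "z \<in> region t"
  shows "0 < s * side a b z \<or> z \<in> closed_segment a b"
  using assms(1)
proof (cases rule: has_edge_cases)
  case (1 u c p a0 b0)
  obtain w where w: "w \<in> region (prototile p)" "z = pose s u c w"
    using assms(2) 1 by (auto simp: region_move)
  have "s * s = 1"
    using 1 frame_square by blast
  moreover have "closed_segment a b = pose s u c ` closed_segment a0 b0"
    using 1 by (simp add: segment_convex_hull pose_hull)
  ultimately show ?thesis
    using proto_side[OF 1(2) w(1)] w(2) 1 side_pose[OF 1(1)]
    by (auto simp flip: mult.assoc)
qed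

lemma side_segment: "z \<in> closed_segment a b \<Longrightarrow> side a b z = 0"
proof -
  assume "z \<in> closed_segment a b"
  then obtain x where z: "z = (1 - x) *\<^sub>R a + x *\<^sub>R b"
    unfolding closed_segment_def by blast
  show ?thesis
    unfolding z by (simp add: side_def inner_complex_def algebra_simps)
qed

section \<open>The dissections\<close>

lemma sqrt_2_bounds: "7 / 5 < sqrt 2" "sqrt 2 < 3 / 2"
   apply (rule real_less_rsqrt, simp add: power2_eq_square)
  apply (rule real_less_lsqrt; simp add: power2_eq_square)
  done

lemma inflation_pos: "0 < inflation"
  by (simp add: inflation_def add_pos_pos)

text \<open>The dissections list some rhombi from an obtuse vertex, whereas
  \<open>unit_rhombus\<close> starts at an acute one; these variants match such lists.\<close>

lemma rhombus_edges_rotated: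
  assumes "unit_rhombus s a b c d"
  shows "has_edge (rhombus d a b c) a b s" "has_edge (rhombus d a b c) a d (- s)"
    "has_edge (rhombus d a b c) c b (- s)" "has_edge (rhombus d a b c) c d s"
  using rhombus_edges[OF assms]
  by (simp_all only: rhombus_sym(3)[where a = d and b = a and c = b and d = c])

text \<open>The invariant of the induction over inflations. The first alternative covers pairs that
  are disjoint or touch in a point; in the second the opposite signs put the tiles on different
  sides of a common directed edge.\<close>

definition compatible :: "tile \<Rightarrow> tile \<Rightarrow> bool" where
  "compatible s t \<longleftrightarrow> (\<forall>x y. x \<in> region s \<inter> region t \<longrightarrow> y \<in> region s \<inter> region t \<longrightarrow> x = y) \<or>
     (\<exists>a b e. has_edge s a b e \<and> has_edge t a b (- e))"

lemma compatible_commute: "compatible s t \<Longrightarrow> compatible t s"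
  unfolding compatible_def by (metis Int_commute minus_minus)

lemma compatible_if_matched:
  "has_edge s a b e \<Longrightarrow> has_edge t a b e' \<Longrightarrow> e' = - e \<Longrightarrow> compatible s t"
  by (auto simp: compatible_def)

lemma separated_meet_once:
  fixes n :: complex
  assumes "\<forall>v\<in>S. v = q \<or> 0 < n \<bullet> (v - q)" "\<forall>v\<in>T. n \<bullet> (v - q) \<le> 0"
    "x \<in> convex hull S \<inter> convex hull T"
  shows "x = q"
  using hull_touches_once[OF assms(1)] hull_le[OF assms(2)] assms(3) by blast

text \<open>The line through \<open>q\<close> with normal \<open>n\<close> separates the tiles. The
  tile \<open>t\<close> may have an edge on it; for disjoint tiles \<open>q\<close> merely fixes the
  line.\<close>

lemma compatible_if_separated:
  fixes n :: complex
  assumes "region s = convex hull S" "region t = convex hull T"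
    "\<forall>v\<in>S. v = q \<or> 0 < n \<bullet> (v - q)" "\<forall>v\<in>T. n \<bullet> (v - q) \<le> 0"
  shows "compatible s t"
  using separated_meet_once[OF assms(3,4)] assms(1,2) unfolding compatible_def by metis

text \<open>
  The directed edges into which the inflated edge from \<open>a\<close> to \<open>b\<close> is divided; the sign tells whether
  they run in the direction from \<open>a\<close> to \<open>b\<close>.
\<close>

definition subedges :: "complex \<Rightarrow> complex \<Rightarrow> (complex \<times> complex \<times> real) set" where
  "subedges a b =
     (let l = inflation; e = sgn (b - a) in
      if norm (b - a) = 1 then {(l *\<^sub>R a, l *\<^sub>R a + e, 1), (l *\<^sub>R a + e, l *\<^sub>R b, 1)}
      else {(l *\<^sub>R a, l *\<^sub>R a + e, 1), (l *\<^sub>R b - e, l *\<^sub>R a + e, -1), (l *\<^sub>R b, l *\<^sub>R b - e, -1)})"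

text \<open>What the induction step must know about the rim of a dissection. As a dissection stays
  on one side of the inflated edge, the second alternative says that \<open>d\<close> touches the
  line of that edge in at most one point. Shrinking \<open>z\<close> allows \<open>side\<close> to
  refer to the edge before inflation.\<close>

definition refines :: "complex \<Rightarrow> complex \<Rightarrow> tile \<Rightarrow> bool" where
  "refines a b d \<longleftrightarrow>
     (\<exists>(a', b', e) \<in> subedges a b. has_edge d a' b' e) \<or>
     (\<exists>q. \<forall>z\<in>region d. side a b (z /\<^sub>R inflation) \<le> 0 \<longrightarrow> z = q)"

lemma refines_if_edge: "has_edge d a' b' e \<Longrightarrow> (a', b', e') \<in> subedges a b \<Longrightarrow> e = e' \<Longrightarrow> refines a b d"
  by (auto simp: refines_def)

text \<open>\<open>n\<close> is the inward normal of the edge rescaled by \<open>k\<close> to simple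
  coordinates.\<close>

lemma refines_if_touching:
  fixes n :: complex
  assumes "region d = convex hull S" "\<forall>v\<in>S. v = q \<or> 0 < n \<bullet> (v - q)"
    "n \<bullet> (q - inflation *\<^sub>R a) = 0" "\<i> * (b - a) = k *\<^sub>R n" "0 < k"
  shows "refines a b d"
proof -
  have "z = q" if z: "z \<in> region d" "side a b (z /\<^sub>R inflation) \<le> 0" for z
  proof (rule hull_touches_once[OF assms(2)])
    have "side a b (z /\<^sub>R inflation) = k / inflation * (n \<bullet> (z - inflation *\<^sub>R a))"
      using inflation_pos by (simp add: side_def assms(4) inner_diff_right field_simps)
    moreover have "n \<bullet> (z - q) = n \<bullet> (z - inflation *\<^sub>R a)"
      using assms(3) by (simp add: inner_diff_right)
    ultimately show "n \<bullet> (z - q) \<le> 0"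
      using z(2) assms(5) inflation_pos by (simp add: mult_le_0_iff divide_le_0_iff)
  qed (use z assms(1) in simp)
  then show ?thesis
    unfolding refines_def by blast
qed

lemma dissection_Triangle_shapes:
  shows
    "right_isosceles 1 (Complex 1 1) (Complex 0 0) (Complex 1 0)"
    "right_isosceles (-1) (Complex (1 + sqrt 2) 0) (Complex 1 0) (Complex (1 + hsq) hsq)"
    "right_isosceles 1 (Complex (2 + hsq) hsq) (Complex (1 + hsq) (1 + hsq)) (Complex (1 + hsq) hsq)"
    "unit_rhombus (-1) (Complex 1 0) (Complex 1 1) (Complex (1 + hsq) (1 + hsq)) (Complex (1 + hsq) hsq)"
    "unit_rhombus 1 (Complex (2 + sqrt 2) 0) (Complex (2 + hsq) hsq) (Complex (1 + hsq) hsq) (Complex (1 + sqrt 2) 0)"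
  by (simp_all add: right_isosceles_def unit_rhombus_def complex_eq_iff power2_eq_square field_simps)

lemma dissection_Rhombus_shapes:
  shows
    "unit_rhombus 1 (Complex 0 0) (Complex 1 0) (Complex (1 + hsq) hsq) (Complex hsq hsq)"
    "unit_rhombus 1 (Complex (1 + sqrt 2) 0) (Complex (1 + sqrt 2) 1) (Complex (1 + hsq) (1 + hsq)) (Complex (1 + hsq) hsq)"
    "unit_rhombus 1 (Complex (1 + sqrt 2) 1) (Complex (1 + sqrt 2 + 1) 1) (Complex (2 + 3 * hsq) (1 + hsq)) (Complex (1 + 3 * hsq) (1 + hsq))"
    "right_isosceles (-1) (Complex hsq hsq) (Complex (1 + hsq) (1 + hsq)) (Complex (1 + hsq) hsq)"
    "right_isosceles 1 (Complex 1 0) (Complex (1 + sqrt 2) 0) (Complex (1 + hsq) hsq)"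
    "right_isosceles (-1) (Complex (1 + sqrt 2 + 1) 1) (Complex (1 + sqrt 2) 0) (Complex (1 + sqrt 2) 1)"
    "right_isosceles 1 (Complex (1 + 3 * hsq) (1 + hsq)) (Complex (1 + hsq) (1 + hsq)) (Complex (1 + sqrt 2) 1)"
  by (simp_all add: right_isosceles_def unit_rhombus_def complex_eq_iff power2_eq_square field_simps)

text \<open>Each pair either has a common edge or is separated by a line. The matched pairs are
  where the arrows of the rule matter: they make the common edge run the same way in both
  tiles.\<close>

lemma dissection_Triangle_compatible:
  assumes "s \<in> dissection Triangle" "t \<in> dissection Triangle" "s \<noteq> t"
  shows "compatible s t"
proof -
  let ?t1 = "triangle (Complex 1 1) (Complex 0 0) (Complex 1 0)"
  let ?t2 = "triangle (Complex (1 + sqrt 2) 0) (Complex 1 0) (Complex (1 + hsq) hsq)"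
  let ?t3 = "triangle (Complex (2 + hsq) hsq) (Complex (1 + hsq) (1 + hsq)) (Complex (1 + hsq) hsq)"
  let ?r1 = "rhombus (Complex 1 0) (Complex 1 1) (Complex (1 + hsq) (1 + hsq)) (Complex (1 + hsq) hsq)"
  let ?r2 = "rhombus (Complex (1 + sqrt 2) 0) (Complex (2 + sqrt 2) 0) (Complex (2 + hsq) hsq) (Complex (1 + hsq) hsq)"
  note b = sqrt_2_bounds
  have c_t1_t2: "compatible ?t1 ?t2"
    by (rule compatible_if_separated[OF region_triangle region_triangle, where n = "Complex (-1) 1" and q = "Complex 1 0"])
      (use b in \<open>simp_all add: inner_complex_def\<close>)
  have c_t1_t3: "compatible ?t1 ?t3"
    by (rule compatible_if_separated[OF region_triangle region_triangle, where n = "Complex (-1) (-1)" and q = "Complex 1 1"])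
      (use b in \<open>simp_all add: inner_complex_def\<close>)
  have c_t1_r1: "compatible ?t1 ?r1"
    by (rule compatible_if_matched[OF triangle_edges(3)[OF dissection_Triangle_shapes(1)]
      rhombus_edges(1)[OF dissection_Triangle_shapes(4)]]) simp
  have c_t1_r2: "compatible ?t1 ?r2"
    by (rule compatible_if_separated[OF region_triangle region_rhombus, where n = "Complex (-1) (-1)" and q = "Complex 1 1"])
      (use b in \<open>simp_all add: inner_complex_def\<close>)
  have c_t2_t3: "compatible ?t2 ?t3"
    by (rule compatible_if_separated[OF region_triangle region_triangle, where n = "Complex 0 (-1)" and q = "Complex (1 + hsq) hsq"])
      (use b in \<open>simp_all add: inner_complex_def\<close>)
  have c_t2_r1: "compatible ?t2 ?r1"
    by (rule compatible_if_matched[OF triangle_edges(2)[OF dissection_Triangle_shapes(2)]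
      rhombus_edges(2)[OF dissection_Triangle_shapes(4)]]) simp
  have c_t2_r2: "compatible ?t2 ?r2"
    by (rule compatible_if_matched[OF triangle_edges(3)[OF dissection_Triangle_shapes(2)]
      rhombus_edges_rotated(4)[OF dissection_Triangle_shapes(5)]]) simp
  have c_t3_r1: "compatible ?t3 ?r1"
    by (rule compatible_if_matched[OF triangle_edges(2)[OF dissection_Triangle_shapes(3)]
      rhombus_edges(4)[OF dissection_Triangle_shapes(4)]]) simp
  have c_t3_r2: "compatible ?t3 ?r2"
    by (rule compatible_if_matched[OF triangle_edges(3)[OF dissection_Triangle_shapes(3)]
      rhombus_edges_rotated(3)[OF dissection_Triangle_shapes(5)]]) simp
  \<comment> \<open>\<open>?r1\<close> has a vertical edge ending at \<open>q\<close>; the normal is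
    tilted away from \<open>Complex (-1) 0\<close> to keep this edge strictly on its side.\<close>
  have c_r1_r2: "compatible ?r1 ?r2"
    by (rule compatible_if_separated[OF region_rhombus region_rhombus, where n = "Complex (-2) 1" and q = "Complex (1 + hsq) hsq"])
      (use b in \<open>simp_all add: inner_complex_def\<close>)
  note c = c_t1_t2
    c_t1_t3
    c_t1_r1
    c_t1_r2
    c_t2_t3
    c_t2_r1
    c_t2_r2
    c_t3_r1
    c_t3_r2
    c_r1_r2
  have "dissection Triangle = {?t1, ?t2, ?t3, ?r1, ?r2}"
    by (simp add: Let_def inflation_def)
  then show ?thesis
    using assms c c[THEN compatible_commute] by auto
qed

lemma dissection_Rhombus_compatible:
  assumes "s \<in> dissection Rhombus" "t \<in> dissection Rhombus" "s \<noteq> t"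
  shows "compatible s t"
proof -
  let ?r1 = "rhombus (Complex 0 0) (Complex 1 0) (Complex (1 + hsq) hsq) (Complex hsq hsq)"
  let ?r2 = "rhombus (Complex (1 + hsq) hsq) (Complex (1 + sqrt 2) 0) (Complex (1 + sqrt 2) 1) (Complex (1 + hsq) (1 + hsq))"
  let ?r3 = "rhombus (Complex (1 + sqrt 2) 1) (Complex (1 + sqrt 2 + 1) 1) (Complex (2 + 3 * hsq) (1 + hsq)) (Complex (1 + 3 * hsq) (1 + hsq))"
  let ?t1 = "triangle (Complex hsq hsq) (Complex (1 + hsq) (1 + hsq)) (Complex (1 + hsq) hsq)"
  let ?t2 = "triangle (Complex 1 0) (Complex (1 + sqrt 2) 0) (Complex (1 + hsq) hsq)"
  let ?t3 = "triangle (Complex (1 + sqrt 2 + 1) 1) (Complex (1 + sqrt 2) 0) (Complex (1 + sqrt 2) 1)"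
  let ?t4 = "triangle (Complex (1 + 3 * hsq) (1 + hsq)) (Complex (1 + hsq) (1 + hsq)) (Complex (1 + sqrt 2) 1)"
  note b = sqrt_2_bounds
  have c_r1_r2: "compatible ?r1 ?r2"
    by (rule compatible_if_separated[OF region_rhombus region_rhombus, where n = "Complex (-1) 0" and q = "Complex (1 + hsq) hsq"])
      (use b in \<open>simp_all add: inner_complex_def\<close>)
  have c_r1_r3: "compatible ?r1 ?r3"
    by (rule compatible_if_separated[OF region_rhombus region_rhombus, where n = "Complex (-1) 0" and q = "Complex (1 + hsq) hsq"])
      (use b in \<open>simp_all add: inner_complex_def\<close>)
  have c_r1_t1: "compatible ?r1 ?t1"
    by (rule compatible_if_matched[OF rhombus_edges(4)[OF dissection_Rhombus_shapes(1)]
      triangle_edges(3)[OF dissection_Rhombus_shapes(4)]]) simp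
  have c_r1_t2: "compatible ?r1 ?t2"
    by (rule compatible_if_matched[OF rhombus_edges(3)[OF dissection_Rhombus_shapes(1)]
      triangle_edges(3)[OF dissection_Rhombus_shapes(5)]]) simp
  have c_r1_t3: "compatible ?r1 ?t3"
    by (rule compatible_if_separated[OF region_rhombus region_triangle, where n = "Complex (-1) 0" and q = "Complex (1 + hsq) hsq"])
      (use b in \<open>simp_all add: inner_complex_def\<close>)
  have c_r1_t4: "compatible ?r1 ?t4"
    by (rule compatible_if_separated[OF region_rhombus region_triangle, where n = "Complex (-1) 0" and q = "Complex (1 + hsq) hsq"])
      (use b in \<open>simp_all add: inner_complex_def\<close>)
  \<comment> \<open>The normal lies strictly between \<open>Complex (-1) 0\<close> and
    \<open>Complex (-1) (-1)\<close>, which are orthogonal to the two edges of \<open>?r2\<close> at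
    \<open>q\<close>.\<close>
  have c_r2_r3: "compatible ?r2 ?r3"
    by (rule compatible_if_separated[OF region_rhombus region_rhombus, where n = "Complex (-2) (-1)" and q = "Complex (1 + sqrt 2) 1"])
      (use b in \<open>simp_all add: inner_complex_def\<close>)
  have c_r2_t1: "compatible ?r2 ?t1"
    by (rule compatible_if_matched[OF rhombus_edges_rotated(4)[OF dissection_Rhombus_shapes(2)]
      triangle_edges(2)[OF dissection_Rhombus_shapes(4)]]) simp
  have c_r2_t2: "compatible ?r2 ?t2"
    by (rule compatible_if_matched[OF rhombus_edges_rotated(2)[OF dissection_Rhombus_shapes(2)]
      triangle_edges(2)[OF dissection_Rhombus_shapes(5)]]) simp
  have c_r2_t3: "compatible ?r2 ?t3"
    by (rule compatible_if_matched[OF rhombus_edges_rotated(1)[OF dissection_Rhombus_shapes(2)]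
      triangle_edges(2)[OF dissection_Rhombus_shapes(6)]]) simp
  have c_r2_t4: "compatible ?r2 ?t4"
    by (rule compatible_if_matched[OF rhombus_edges_rotated(3)[OF dissection_Rhombus_shapes(2)]
      triangle_edges(2)[OF dissection_Rhombus_shapes(7)]]) simp
  have c_r3_t1: "compatible ?r3 ?t1"
    by (rule compatible_if_separated[OF region_rhombus region_triangle, where n = "Complex 1 0" and q = "Complex (1 + sqrt 2) 1"])
      (use b in \<open>simp_all add: inner_complex_def\<close>)
  have c_r3_t2: "compatible ?r3 ?t2"
    by (rule compatible_if_separated[OF region_rhombus region_triangle, where n = "Complex 1 0" and q = "Complex (1 + sqrt 2) 1"])
      (use b in \<open>simp_all add: inner_complex_def\<close>)
  have c_r3_t3: "compatible ?r3 ?t3"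
    by (rule compatible_if_matched[OF rhombus_edges(1)[OF dissection_Rhombus_shapes(3)]
      triangle_edges(3)[OF dissection_Rhombus_shapes(6)]]) simp
  have c_r3_t4: "compatible ?r3 ?t4"
    by (rule compatible_if_matched[OF rhombus_edges(2)[OF dissection_Rhombus_shapes(3)]
      triangle_edges(3)[OF dissection_Rhombus_shapes(7)]]) simp
  have c_t1_t2: "compatible ?t1 ?t2"
    by (rule compatible_if_separated[OF region_triangle region_triangle, where n = "Complex (-1) 1" and q = "Complex (1 + hsq) hsq"])
      (use b in \<open>simp_all add: inner_complex_def\<close>)
  have c_t1_t3: "compatible ?t1 ?t3"
    by (rule compatible_if_separated[OF region_triangle region_triangle, where n = "Complex (-1) 1" and q = "Complex (1 + hsq) hsq"])
      (use b in \<open>simp_all add: inner_complex_def\<close>)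
  have c_t1_t4: "compatible ?t1 ?t4"
    by (rule compatible_if_separated[OF region_triangle region_triangle, where n = "Complex (-1) (-1)" and q = "Complex (1 + hsq) (1 + hsq)"])
      (use b in \<open>simp_all add: inner_complex_def\<close>)
  have c_t2_t3: "compatible ?t2 ?t3"
    by (rule compatible_if_separated[OF region_triangle region_triangle, where n = "Complex (-1) 0" and q = "Complex (1 + sqrt 2) 0"])
      (use b in \<open>simp_all add: inner_complex_def\<close>)
  have c_t2_t4: "compatible ?t2 ?t4"
    by (rule compatible_if_separated[OF region_triangle region_triangle, where n = "Complex 0 (-1)" and q = "Complex (1 + hsq) hsq"])
      (use b in \<open>simp_all add: inner_complex_def\<close>)
  have c_t3_t4: "compatible ?t3 ?t4"
    by (rule compatible_if_separated[OF region_triangle region_triangle, where n = "Complex 1 (-1)" and q = "Complex (1 + sqrt 2) 1"])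
      (use b in \<open>simp_all add: inner_complex_def\<close>)
  note c = c_r1_r2
    c_r1_r3
    c_r1_t1
    c_r1_t2
    c_r1_t3
    c_r1_t4
    c_r2_r3
    c_r2_t1
    c_r2_t2
    c_r2_t3
    c_r2_t4
    c_r3_t1
    c_r3_t2
    c_r3_t3
    c_r3_t4
    c_t1_t2
    c_t1_t3
    c_t1_t4
    c_t2_t3
    c_t2_t4
    c_t3_t4
  have "dissection Rhombus = {?r1, ?r2, ?r3, ?t1, ?t2, ?t3, ?t4}"
    by (simp add: Let_def inflation_def)
  then show ?thesis
    using assms c c[THEN compatible_commute] by auto
qed

lemma subedges_Triangle_1:
  shows "(Complex 0 0, Complex 1 0, 1) \<in> subedges 0 (Complex (sqrt 2) 0)"
    "(Complex (1 + sqrt 2) 0, Complex 1 0, -1) \<in> subedges 0 (Complex (sqrt 2) 0)"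
    "(Complex (2 + sqrt 2) 0, Complex (1 + sqrt 2) 0, -1) \<in> subedges 0 (Complex (sqrt 2) 0)"
  by (simp_all add: subedges_def Let_def inflation_def sgn_div_norm cmod_def power2_eq_square
      complex_eq_iff field_simps)

lemma subedges_Triangle_2:
  shows "(Complex (2 + sqrt 2) 0, Complex (2 + hsq) hsq, 1) \<in> subedges (Complex (sqrt 2) 0) (Complex hsq hsq)"
    "(Complex (2 + hsq) hsq, Complex (1 + hsq) (1 + hsq), 1) \<in> subedges (Complex (sqrt 2) 0) (Complex hsq hsq)"
  by (simp_all add: subedges_def Let_def inflation_def sgn_div_norm cmod_def power2_eq_square
      complex_eq_iff field_simps)

lemma subedges_Triangle_3:
  shows "(Complex (1 + hsq) (1 + hsq), Complex 1 1, 1) \<in> subedges (Complex hsq hsq) 0"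
    "(Complex 1 1, Complex 0 0, 1) \<in> subedges (Complex hsq hsq) 0"
  by (simp_all add: subedges_def Let_def inflation_def sgn_div_norm cmod_def power2_eq_square
      complex_eq_iff field_simps)

lemma subedges_Rhombus_1:
  shows "(Complex 0 0, Complex 1 0, 1) \<in> subedges 0 1"
    "(Complex 1 0, Complex (1 + sqrt 2) 0, 1) \<in> subedges 0 1"
  by (simp_all add: subedges_def Let_def inflation_def sgn_div_norm cmod_def power2_eq_square
      complex_eq_iff field_simps)

lemma dissection_Triangle_refines:
  assumes "(a, b) \<in> proto_edges Triangle" "d \<in> dissection Triangle"
  shows "refines a b d"
proof -
  let ?t1 = "triangle (Complex 1 1) (Complex 0 0) (Complex 1 0)"
  let ?t2 = "triangle (Complex (1 + sqrt 2) 0) (Complex 1 0) (Complex (1 + hsq) hsq)"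
  let ?t3 = "triangle (Complex (2 + hsq) hsq) (Complex (1 + hsq) (1 + hsq)) (Complex (1 + hsq) hsq)"
  let ?r1 = "rhombus (Complex 1 0) (Complex 1 1) (Complex (1 + hsq) (1 + hsq)) (Complex (1 + hsq) hsq)"
  let ?r2 = "rhombus (Complex (1 + sqrt 2) 0) (Complex (2 + sqrt 2) 0) (Complex (2 + hsq) hsq) (Complex (1 + hsq) hsq)"
  note b = sqrt_2_bounds
  have e1_t1: "refines 0 (Complex (sqrt 2) 0) ?t1"
    by (rule refines_if_edge[OF triangle_edges(2)[OF dissection_Triangle_shapes(1)]
      subedges_Triangle_1(1)]) simp
  have e1_t2: "refines 0 (Complex (sqrt 2) 0) ?t2"
    by (rule refines_if_edge[OF triangle_edges(1)[OF dissection_Triangle_shapes(2)]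
      subedges_Triangle_1(2)]) simp
  \<comment> \<open>The tile lies strictly above the line; here and in similar cases below,
    \<open>q\<close> is just some point of the line.\<close>
  have e1_t3: "refines 0 (Complex (sqrt 2) 0) ?t3"
    by (rule refines_if_touching[OF region_triangle, where n = "Complex 0 1" and q = "Complex 0 0" and k = "sqrt 2"])
      (use b in \<open>simp add: inner_complex_def\<close>,
        simp_all add: inner_complex_def complex_eq_iff inflation_def algebra_simps)
  have e1_r1: "refines 0 (Complex (sqrt 2) 0) ?r1"
    by (rule refines_if_touching[OF region_rhombus, where n = "Complex 0 1" and q = "Complex 1 0" and k = "sqrt 2"])
      (use b in \<open>simp add: inner_complex_def\<close>,
        simp_all add: inner_complex_def complex_eq_iff inflation_def algebra_simps)
  have e1_r2: "refines 0 (Complex (sqrt 2) 0) ?r2"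
    by (rule refines_if_edge[OF rhombus_edges_rotated(2)[OF dissection_Triangle_shapes(5)]
      subedges_Triangle_1(3)]) simp
  have e2_t1: "refines (Complex (sqrt 2) 0) (Complex hsq hsq) ?t1"
    by (rule refines_if_touching[OF region_triangle, where n = "Complex (-1) (-1)" and q = "Complex (2 + sqrt 2) 0" and k = "hsq"])
      (use b in \<open>simp add: inner_complex_def\<close>,
        simp_all add: inner_complex_def complex_eq_iff inflation_def algebra_simps)
  have e2_t2: "refines (Complex (sqrt 2) 0) (Complex hsq hsq) ?t2"
    by (rule refines_if_touching[OF region_triangle, where n = "Complex (-1) (-1)" and q = "Complex (2 + sqrt 2) 0" and k = "hsq"])
      (use b in \<open>simp add: inner_complex_def\<close>,
        simp_all add: inner_complex_def complex_eq_iff inflation_def algebra_simps)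
  have e2_t3: "refines (Complex (sqrt 2) 0) (Complex hsq hsq) ?t3"
    by (rule refines_if_edge[OF triangle_edges(1)[OF dissection_Triangle_shapes(3)]
      subedges_Triangle_2(2)]) simp
  have e2_r1: "refines (Complex (sqrt 2) 0) (Complex hsq hsq) ?r1"
    by (rule refines_if_touching[OF region_rhombus, where n = "Complex (-1) (-1)" and q = "Complex (1 + hsq) (1 + hsq)" and k = "hsq"])
      (use b in \<open>simp add: inner_complex_def\<close>,
        simp_all add: inner_complex_def complex_eq_iff inflation_def algebra_simps)
  have e2_r2: "refines (Complex (sqrt 2) 0) (Complex hsq hsq) ?r2"
    by (rule refines_if_edge[OF rhombus_edges_rotated(1)[OF dissection_Triangle_shapes(5)]
      subedges_Triangle_2(1)]) simp
  have e3_t1: "refines (Complex hsq hsq) 0 ?t1"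
    by (rule refines_if_edge[OF triangle_edges(1)[OF dissection_Triangle_shapes(1)]
      subedges_Triangle_3(2)]) simp
  have e3_t2: "refines (Complex hsq hsq) 0 ?t2"
    by (rule refines_if_touching[OF region_triangle, where n = "Complex 1 (-1)" and q = "Complex (1 + hsq) (1 + hsq)" and k = "hsq"])
      (use b in \<open>simp add: inner_complex_def\<close>,
        simp_all add: inner_complex_def complex_eq_iff inflation_def algebra_simps)
  have e3_t3: "refines (Complex hsq hsq) 0 ?t3"
    by (rule refines_if_touching[OF region_triangle, where n = "Complex 1 (-1)" and q = "Complex (1 + hsq) (1 + hsq)" and k = "hsq"])
      (use b in \<open>simp add: inner_complex_def\<close>,
        simp_all add: inner_complex_def complex_eq_iff inflation_def algebra_simps)
  have e3_r1: "refines (Complex hsq hsq) 0 ?r1"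
    by (rule refines_if_edge[OF rhombus_edges(3)[OF dissection_Triangle_shapes(4)]
      subedges_Triangle_3(1)]) simp
  have e3_r2: "refines (Complex hsq hsq) 0 ?r2"
    by (rule refines_if_touching[OF region_rhombus, where n = "Complex 1 (-1)" and q = "Complex (1 + hsq) (1 + hsq)" and k = "hsq"])
      (use b in \<open>simp add: inner_complex_def\<close>,
        simp_all add: inner_complex_def complex_eq_iff inflation_def algebra_simps)
  have "dissection Triangle = {?t1, ?t2, ?t3, ?r1, ?r2}"
    by (simp add: Let_def inflation_def)
  then show ?thesis
    using assms e1_t1
      e1_t2
      e1_t3
      e1_r1
      e1_r2
      e2_t1
      e2_t2
      e2_t3
      e2_r1
      e2_r2
      e3_t1
      e3_t2
      e3_t3
      e3_r1
      e3_r2 by auto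
qed

lemma dissection_Rhombus_refines:
  assumes "(a, b) \<in> proto_edges Rhombus" "d \<in> dissection Rhombus"
  shows "refines a b d"
proof -
  let ?r1 = "rhombus (Complex 0 0) (Complex 1 0) (Complex (1 + hsq) hsq) (Complex hsq hsq)"
  let ?r2 = "rhombus (Complex (1 + hsq) hsq) (Complex (1 + sqrt 2) 0) (Complex (1 + sqrt 2) 1) (Complex (1 + hsq) (1 + hsq))"
  let ?r3 = "rhombus (Complex (1 + sqrt 2) 1) (Complex (1 + sqrt 2 + 1) 1) (Complex (2 + 3 * hsq) (1 + hsq)) (Complex (1 + 3 * hsq) (1 + hsq))"
  let ?t1 = "triangle (Complex hsq hsq) (Complex (1 + hsq) (1 + hsq)) (Complex (1 + hsq) hsq)"
  let ?t2 = "triangle (Complex 1 0) (Complex (1 + sqrt 2) 0) (Complex (1 + hsq) hsq)"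
  let ?t3 = "triangle (Complex (1 + sqrt 2 + 1) 1) (Complex (1 + sqrt 2) 0) (Complex (1 + sqrt 2) 1)"
  let ?t4 = "triangle (Complex (1 + 3 * hsq) (1 + hsq)) (Complex (1 + hsq) (1 + hsq)) (Complex (1 + sqrt 2) 1)"
  note b = sqrt_2_bounds
  have e1_r1: "refines 0 1 ?r1"
    by (rule refines_if_edge[OF rhombus_edges(1)[OF dissection_Rhombus_shapes(1)]
      subedges_Rhombus_1(1)]) simp
  have e1_r2: "refines 0 1 ?r2"
    by (rule refines_if_touching[OF region_rhombus, where n = "Complex 0 1" and q = "Complex (1 + sqrt 2) 0" and k = "1"])
      (use b in \<open>simp add: inner_complex_def\<close>,
        simp_all add: inner_complex_def complex_eq_iff inflation_def algebra_simps)
  have e1_r3: "refines 0 1 ?r3"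
    by (rule refines_if_touching[OF region_rhombus, where n = "Complex 0 1" and q = "Complex 0 0" and k = "1"])
      (use b in \<open>simp add: inner_complex_def\<close>,
        simp_all add: inner_complex_def complex_eq_iff inflation_def algebra_simps)
  have e1_t1: "refines 0 1 ?t1"
    by (rule refines_if_touching[OF region_triangle, where n = "Complex 0 1" and q = "Complex 0 0" and k = "1"])
      (use b in \<open>simp add: inner_complex_def\<close>,
        simp_all add: inner_complex_def complex_eq_iff inflation_def algebra_simps)
  have e1_t2: "refines 0 1 ?t2"
    by (rule refines_if_edge[OF triangle_edges(1)[OF dissection_Rhombus_shapes(5)]
      subedges_Rhombus_1(2)]) simp
  have e1_t3: "refines 0 1 ?t3"
    by (rule refines_if_touching[OF region_triangle, where n = "Complex 0 1" and q = "Complex (1 + sqrt 2) 0" and k = "1"])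
      (use b in \<open>simp add: inner_complex_def\<close>,
        simp_all add: inner_complex_def complex_eq_iff inflation_def algebra_simps)
  have e1_t4: "refines 0 1 ?t4"
    by (rule refines_if_touching[OF region_triangle, where n = "Complex 0 1" and q = "Complex 0 0" and k = "1"])
      (use b in \<open>simp add: inner_complex_def\<close>,
        simp_all add: inner_complex_def complex_eq_iff inflation_def algebra_simps)
  have "dissection Rhombus = {?r1, ?r2, ?r3, ?t1, ?t2, ?t3, ?t4}"
    by (simp add: Let_def inflation_def)
  then show ?thesis
    using assms e1_r1
      e1_r2
      e1_r3
      e1_t1
      e1_t2
      e1_t3
      e1_t4 by auto
qed

lemma tile_of_edge:
  assumes "has_edge t a b s"
  obtains u c p where "frame s u" "t = move (pose s u c) (prototile p)"
  using assms by (auto elim: has_edge_cases)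

text \<open>Having an edge at all makes \<open>d\<close> a congruent copy, by
  \<open>tile_of_edge\<close>.\<close>

lemma dissection_has_edge:
  assumes "d \<in> dissection p"
  obtains a b s where "has_edge d a b s"
proof (cases p)
  case Triangle
  show thesis
    using assms that dissection_Triangle_shapes(1-3)[THEN triangle_edges(1)]
      rhombus_edges(1)[OF dissection_Triangle_shapes(4)] rhombus_edges_rotated(1)[OF dissection_Triangle_shapes(5)]
    unfolding Triangle dissection.simps Let_def by blast
next
  case Rhombus
  show thesis
    using assms that dissection_Rhombus_shapes(4-7)[THEN triangle_edges(1)]
      dissection_Rhombus_shapes(1,3)[THEN rhombus_edges(1)] rhombus_edges_rotated(1)[OF dissection_Rhombus_shapes(2)]
    unfolding Rhombus dissection.simps Let_def inflation_def by blast
qed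

section \<open>Dissections stay inside the expanded prototiles\<close>

lemma convex_right_isosceles:
  "convex {z. 0 \<le> Im z \<and> Im z \<le> Re z \<and> Re z + Im z \<le> k}"
proof -
  have "{z. 0 \<le> Im z \<and> Im z \<le> Re z \<and> Re z + Im z \<le> k} =
      {z. Complex 0 (-1) \<bullet> z \<le> 0} \<inter> {z. Complex (-1) 1 \<bullet> z \<le> 0} \<inter> {z. Complex 1 1 \<bullet> z \<le> k}"
    by (auto simp: inner_complex_def)
  then show ?thesis
    by (simp add: convex_Int convex_halfspace_le)
qed

lemma convex_strip:
  "convex {z. 0 \<le> Im z \<and> Im z \<le> k \<and> Im z \<le> Re z \<and> Re z - Im z \<le> l}"
proof -
  have "{z. 0 \<le> Im z \<and> Im z \<le> k \<and> Im z \<le> Re z \<and> Re z - Im z \<le> l} =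
      {z. Complex 0 (-1) \<bullet> z \<le> 0} \<inter> {z. Complex 0 1 \<bullet> z \<le> k} \<inter>
      {z. Complex (-1) 1 \<bullet> z \<le> 0} \<inter> {z. Complex 1 (-1) \<bullet> z \<le> l}"
    by (auto simp: inner_complex_def)
  then show ?thesis
    by (simp add: convex_Int convex_halfspace_le)
qed

lemma in_proto_triangle:
  assumes "0 \<le> Im z" "Im z \<le> Re z" "Re z + Im z \<le> sqrt 2"
  shows "z \<in> region (prototile Triangle)"
proof -
  \<comment> \<open>\<open>f\<close> and \<open>g\<close> are the barycentric weights of the head
    and the apex.\<close>
  define g where "g = sqrt 2 * Im z"
  define f where "f = (Re z - Im z) / sqrt 2"
  have "f + g = (Re z + Im z) / sqrt 2"
    by (simp add: f_def g_def field_simps)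
  then have "f + g \<le> 1"
    using assms(3) by simp
  moreover have "0 \<le> f" "0 \<le> g"
    using assms by (simp_all add: f_def g_def)
  moreover have "z = (1 - f - g) *\<^sub>R Complex 0 0 + f *\<^sub>R Complex (sqrt 2) 0 + g *\<^sub>R Complex hsq hsq"
    by (simp add: complex_eq_iff f_def g_def)
  ultimately show ?thesis
    unfolding prototile.simps Let_def region_triangle convex_hull_3
    by (intro CollectI exI[of _ "1 - f - g"] exI[of _ f] exI[of _ g]) simp
qed

lemma in_proto_rhombus:
  assumes "0 \<le> Im z" "Im z \<le> hsq" "Im z \<le> Re z" "Re z - Im z \<le> 1"
  shows "z \<in> region (prototile Rhombus)"
proof -
  \<comment> \<open>Coordinates with respect to the edge vectors \<open>1\<close> and
    \<open>Complex hsq hsq\<close>, in which the rhombus is the unit square.\<close>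
  define x where "x = Re z - Im z"
  define y where "y = sqrt 2 * Im z"
  let ?S = "{Complex 0 0, Complex 1 0, Complex (1 + hsq) hsq, Complex hsq hsq}"
  have "y \<le> sqrt 2 * hsq"
    unfolding y_def using assms(2) by (intro mult_left_mono) auto
  then have xy: "0 \<le> x" "x \<le> 1" "0 \<le> y" "y \<le> 1"
    using assms by (auto simp: x_def y_def)
  have mem: "Complex 0 0 \<in> convex hull ?S" "Complex 1 0 \<in> convex hull ?S"
    "Complex (1 + hsq) hsq \<in> convex hull ?S" "Complex hsq hsq \<in> convex hull ?S"
    by (auto intro: hull_inc)
  have "(1 - x) *\<^sub>R Complex 0 0 + x *\<^sub>R Complex 1 0 \<in> convex hull ?S"
    "(1 - x) *\<^sub>R Complex hsq hsq + x *\<^sub>R Complex (1 + hsq) hsq \<in> convex hull ?S"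
    by (rule convexD[OF convex_convex_hull]; use xy mem in simp)+
  then have "(1 - y) *\<^sub>R ((1 - x) *\<^sub>R Complex 0 0 + x *\<^sub>R Complex 1 0) +
      y *\<^sub>R ((1 - x) *\<^sub>R Complex hsq hsq + x *\<^sub>R Complex (1 + hsq) hsq) \<in> convex hull ?S"
    by (rule convexD[OF convex_convex_hull]) (use xy in simp_all)
  also have "(1 - y) *\<^sub>R ((1 - x) *\<^sub>R Complex 0 0 + x *\<^sub>R Complex 1 0) +
      y *\<^sub>R ((1 - x) *\<^sub>R Complex hsq hsq + x *\<^sub>R Complex (1 + hsq) hsq) = z"
    by (simp add: complex_eq_iff x_def y_def algebra_simps)
  finally show ?thesis
    by (simp add: Let_def region_rhombus)
qed

text \<open>Both prototiles are described by linear inequalities, so it suffices to test the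
  vertices of \<open>d\<close> against these inequalities scaled by \<open>inflation\<close>. It
  follows that children of tiles with at most one common point have at most one common
  point.\<close>

lemma dissection_subset:
  assumes "d \<in> dissection p" "z \<in> region d"
  shows "z /\<^sub>R inflation \<in> region (prototile p)"
proof (cases p)
  case Triangle
  define K where "K = {z. 0 \<le> Im z \<and> Im z \<le> Re z \<and> Re z + Im z \<le> 2 + sqrt 2}"
  have K: "(convex hull V \<subseteq> K) = (V \<subseteq> K)" for V
    unfolding K_def by (rule subset_hull, rule convex_right_isosceles)
  have "region d \<subseteq> K"
    using assms(1) sqrt_2_bounds unfolding Triangle dissection.simps Let_def
    by (elim insertE emptyE) (simp_all add: region_triangle region_rhombus K, simp_all add: K_def)
  moreover have "2 + sqrt 2 = inflation * sqrt 2"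
    by (simp add: inflation_def algebra_simps)
  ultimately show ?thesis
    using assms(2) inflation_pos unfolding Triangle K_def
    by (intro in_proto_triangle) (auto simp: field_simps)
next
  case Rhombus
  define K where "K = {z. 0 \<le> Im z \<and> Im z \<le> 1 + hsq \<and> Im z \<le> Re z \<and> Re z - Im z \<le> inflation}"
  have K: "(convex hull V \<subseteq> K) = (V \<subseteq> K)" for V
    unfolding K_def by (rule subset_hull, rule convex_strip)
  have "region d \<subseteq> K"
    using assms(1) sqrt_2_bounds unfolding Rhombus dissection.simps Let_def
    by (elim insertE emptyE) (simp_all add: region_triangle region_rhombus K, simp_all add: K_def inflation_def)
  moreover have "1 + hsq = inflation * hsq"
    by (simp add: inflation_def algebra_simps)
  ultimately show ?thesis
    using assms(2) inflation_pos unfolding Rhombus K_def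
    by (intro in_proto_rhombus) (auto simp: field_simps)
qed

section \<open>Symmetries and colours of a single tile\<close>

lemma pose_eqD:
  assumes "frame e u" "pose e u c = pose e' u' c'"
  shows "e = e'" "u = u'" "c = c'"
proof -
  have *: "pose e u c z = pose e' u' c' z" for z
    using assms(2) by simp
  show c: "c = c'"
    using *[of 0] by (simp add: pose_def zero_complex.ctr[symmetric])
  show u: "u = u'"
    using *[of 1] c by (simp add: pose_def one_complex.ctr[symmetric])
  have "u * Complex 0 e = u * Complex 0 e'"
    using *[of \<i>] c u by (simp add: pose_def)
  then show "e = e'"
    using assms(1) by (auto simp: frame_def)
qed

lemma proto_rhombus_bounds:
  assumes "z \<in> region (prototile Rhombus)"
  shows "0 \<le> Im z" "Im z \<le> hsq" "Im z \<le> Re z" "Re z - Im z \<le> 1"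
proof -
  have "region (prototile Rhombus) \<subseteq> {z. 0 \<le> Im z \<and> Im z \<le> hsq \<and> Im z \<le> Re z \<and> Re z - Im z \<le> 1}"
    unfolding prototile.simps Let_def region_rhombus
    by (rule hull_minimal[where S = convex, OF _ convex_strip]) simp
  then show "0 \<le> Im z" "Im z \<le> hsq" "Im z \<le> Re z" "Re z - Im z \<le> 1"
    using assms by auto
qed

text \<open>In coordinates along the edge vectors the differences \<open>p\<close> and
  \<open>q\<close> lie between \<open>-1\<close> and \<open>1\<close>, and the squared distance
  \<open>p^2 + q^2 + sqrt 2 * p * q\<close> reaches \<open>2 + sqrt 2\<close> only for
  \<open>p = q = 1\<close> and \<open>p = q = -1\<close>.\<close>

lemma proto_rhombus_diagonal:
  assumes "x \<in> region (prototile Rhombus)" "y \<in> region (prototile Rhombus)"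
    and "norm (x - y) = norm (Complex (1 + hsq) hsq)"
  shows "x = 0 \<and> y = Complex (1 + hsq) hsq \<or> x = Complex (1 + hsq) hsq \<and> y = 0"
proof -
  define r where "r z = Re z - Im z" for z
  define i where "i z = sqrt 2 * Im z" for z
  have z: "Im z = hsq * i z" "Re z = r z + hsq * i z" for z
    by (simp_all add: r_def i_def)
  have bd: "0 \<le> r z \<and> r z \<le> 1 \<and> 0 \<le> i z \<and> i z \<le> 1" if "z \<in> region (prototile Rhombus)" for z
  proof -
    have "i z \<le> sqrt 2 * hsq"
      unfolding i_def using proto_rhombus_bounds[OF that] by (intro mult_left_mono) auto
    then show ?thesis
      using proto_rhombus_bounds[OF that] by (simp add: r_def i_def)
  qed
  define p q where "p = r x - r y" and "q = i x - i y"
  have "(norm (x - y))\<^sup>2 = (p + hsq * q)\<^sup>2 + (hsq * q)\<^sup>2"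
    unfolding cmod_power2 minus_complex.sel unfolding z p_def q_def
    by (simp add: algebra_simps diff_divide_distrib)
  also have "\<dots> = p\<^sup>2 + q\<^sup>2 + sqrt 2 * (p * q)"
    by (simp add: power2_eq_square field_simps)
  finally have "p\<^sup>2 + q\<^sup>2 + sqrt 2 * (p * q) = 2 + sqrt 2"
    unfolding assms(3) cmod_power2 by (simp add: power2_eq_square field_simps)
  moreover have pq: "\<bar>p\<bar> \<le> 1" "\<bar>q\<bar> \<le> 1"
    using bd[OF assms(1)] bd[OF assms(2)] by (auto simp: p_def q_def)
  then have "p\<^sup>2 \<le> 1" "q\<^sup>2 \<le> 1" "p * q \<le> 1"
    using mult_mono[of "\<bar>p\<bar>" 1 "\<bar>q\<bar>" 1] by (auto simp: abs_square_le_1 simp flip: abs_mult)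
  moreover from this have "sqrt 2 * (p * q) \<le> sqrt 2"
    by simp
  ultimately have "p\<^sup>2 = 1" "q\<^sup>2 = 1" "sqrt 2 * (p * q) = sqrt 2"
    by linarith+
  then have "p = 1 \<and> q = 1 \<or> p = -1 \<and> q = -1"
    by (auto simp: power2_eq_1_iff)
  then have "r x = 1 \<and> r y = 0 \<and> i x = 1 \<and> i y = 0 \<or> r x = 0 \<and> r y = 1 \<and> i x = 0 \<and> i y = 1"
    using bd[OF assms(1)] bd[OF assms(2)] by (auto simp: p_def q_def)
  then show ?thesis
    using z[of x] z[of y] by (auto simp: complex_eq_iff)
qed

text \<open>The acute vertices are the only points at the distance of the long diagonal, so they are
  fixed or swapped, with either orientation. The four results are the identity, the half turn about
  the centre and the reflections in the long and the short diagonal.\<close>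

lemma rhombus_stabilizer:
  assumes "frame e u" "pose e u c ` region (prototile Rhombus) = region (prototile Rhombus)"
  shows "(e, u, c) \<in> {(1, 1, 0), (1, -1, Complex (1 + hsq) hsq), (-1, Complex hsq hsq, 0),
    (-1, - Complex hsq hsq, Complex (1 + hsq) hsq)}"
proof -
  let ?C = "Complex (1 + hsq) hsq"
  have "0 \<in> region (prototile Rhombus)" "?C \<in> region (prototile Rhombus)"
    by (auto simp: Let_def region_rhombus zero_complex.ctr intro: hull_inc)
  then have mem: "pose e u c 0 \<in> region (prototile Rhombus)" "pose e u c ?C \<in> region (prototile Rhombus)"
    using assms(2) by blast+
  have "norm (pose e u c 0 - pose e u c ?C) = norm ?C"
    unfolding norm_pose_diff[OF assms(1)] by (simp only: diff_0 norm_minus_cancel)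
  from proto_rhombus_diagonal[OF mem this] have *: "pose e u c 0 = 0 \<and> pose e u c ?C = ?C \<or> pose e u c 0 = ?C \<and> pose e u c ?C = 0"
    by blast
  have "pose e u c 0 = c" "pose e u c ?C = u * Complex (1 + hsq) (e * hsq) + c"
    by (simp_all add: pose_def flip: zero_complex.ctr)
  with * have **: "u * Complex (1 + hsq) (e * hsq) = ?C \<and> c = 0 \<or> u * Complex (1 + hsq) (e * hsq) = - ?C \<and> c = ?C"
    by (auto simp: eq_neg_iff_add_eq_0)
  have C: "?C \<noteq> 0" "Complex (1 + hsq) (- hsq) \<noteq> 0"
    using sqrt_2_bounds by (auto simp: complex_eq_iff)
  \<comment> \<open>The acute vertex \<open>?C\<close> lies on the axis of the reflection in the
    long diagonal.\<close>
  have Z: "Complex hsq hsq * Complex (1 + hsq) (- hsq) = ?C"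
    by (simp add: complex_eq_iff algebra_simps)
  consider "e = 1" | "e = -1"
    using assms(1) by (auto simp: frame_def)
  then show ?thesis
  proof cases
    case 1
    have "u * ?C = 1 * ?C \<and> c = 0 \<or> u * ?C = (-1) * ?C \<and> c = ?C"
      using ** by (simp only: 1 mult_1 mult_minus_left)
    then show ?thesis
      using C unfolding mult_cancel_right by (auto simp: 1)
  next
    case 2
    have "u * Complex (1 + hsq) (- hsq) = Complex hsq hsq * Complex (1 + hsq) (- hsq) \<and> c = 0 \<or>
      u * Complex (1 + hsq) (- hsq) = (- Complex hsq hsq) * Complex (1 + hsq) (- hsq) \<and> c = ?C"
      using ** by (simp only: 2 Z mult_1 mult_minus_left)
    then show ?thesis
      using C unfolding mult_cancel_right by (auto simp: 2)
  qed
qed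

text \<open>The arrow fixes tail and head, which leaves only the identity and the reflection in the
  hypotenuse; the latter moves the apex out of the tile.\<close>

lemma triangle_stabilizer:
  assumes "frame e u" "move (pose e u c) (prototile Triangle) = prototile Triangle"
  shows "e = 1" "u = 1" "c = 0"
proof -
  have *: "pose e u c 0 = 0" "pose e u c (Complex (sqrt 2) 0) = Complex (sqrt 2) 0"
    using assms(2) by (auto simp: move_def triangle_def zero_complex.ctr Let_def)
  then show c: "c = 0"
    by (simp add: pose_def flip: zero_complex.ctr)
  have "u * complex_of_real (sqrt 2) = 1 * complex_of_real (sqrt 2)"
    using * c by (simp add: pose_def complex_of_real_def)
  then show u: "u = 1"
    by simp
  have "Complex hsq hsq \<in> region (prototile Triangle)"
    by (auto simp: Let_def region_triangle intro: hull_inc)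
  then have "pose e u c (Complex hsq hsq) \<in> region (prototile Triangle)"
    using assms(2) by (metis imageI region_move)
  moreover have "region (prototile Triangle) \<subseteq> {z. 0 \<le> Im z \<and> Im z \<le> Re z \<and> Re z + Im z \<le> sqrt 2}"
    unfolding prototile.simps Let_def region_triangle
    by (rule hull_minimal) (simp_all add: convex_right_isosceles)
  ultimately have "0 \<le> e * hsq"
    by (auto simp: pose_def u c)
  then show "e = 1"
    using assms(1) by (auto simp: frame_def)
qed

text \<open>The half turn about the centre of the expanded rhombus permutes the ten vertices of the
  dissection, so images of tiles can be rewritten into tiles of the list.\<close>

lemma dissection_Rhombus_point_vertices:
  shows
    "pose 1 (-1) ((1 + sqrt 2) *\<^sub>R (Complex (1 + hsq) hsq)) (Complex 0 0) = Complex (2 + 3 * hsq) (1 + hsq)"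
    "pose 1 (-1) ((1 + sqrt 2) *\<^sub>R (Complex (1 + hsq) hsq)) (Complex 1 0) = Complex (1 + 3 * hsq) (1 + hsq)"
    "pose 1 (-1) ((1 + sqrt 2) *\<^sub>R (Complex (1 + hsq) hsq)) (Complex (1 + hsq) hsq) = Complex (1 + sqrt 2) 1"
    "pose 1 (-1) ((1 + sqrt 2) *\<^sub>R (Complex (1 + hsq) hsq)) (Complex hsq hsq) = Complex (1 + sqrt 2 + 1) 1"
    "pose 1 (-1) ((1 + sqrt 2) *\<^sub>R (Complex (1 + hsq) hsq)) (Complex (1 + sqrt 2) 0) = Complex (1 + hsq) (1 + hsq)"
    "pose 1 (-1) ((1 + sqrt 2) *\<^sub>R (Complex (1 + hsq) hsq)) (Complex (1 + sqrt 2) 1) = Complex (1 + hsq) hsq"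
    "pose 1 (-1) ((1 + sqrt 2) *\<^sub>R (Complex (1 + hsq) hsq)) (Complex (1 + hsq) (1 + hsq)) = Complex (1 + sqrt 2) 0"
    "pose 1 (-1) ((1 + sqrt 2) *\<^sub>R (Complex (1 + hsq) hsq)) (Complex (1 + sqrt 2 + 1) 1) = Complex hsq hsq"
    "pose 1 (-1) ((1 + sqrt 2) *\<^sub>R (Complex (1 + hsq) hsq)) (Complex (2 + 3 * hsq) (1 + hsq)) = Complex 0 0"
    "pose 1 (-1) ((1 + sqrt 2) *\<^sub>R (Complex (1 + hsq) hsq)) (Complex (1 + 3 * hsq) (1 + hsq)) = Complex 1 0"
  by (simp_all add: pose_def complex_eq_iff algebra_simps add_divide_distrib)

lemma dissection_Rhombus_point_symmetric:
  assumes "d \<in> dissection Rhombus"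
  shows "move (pose 1 (-1) (inflation *\<^sub>R (Complex (1 + hsq) hsq))) d \<in> dissection Rhombus"
proof -
  note v = dissection_Rhombus_point_vertices
  show ?thesis
    using assms unfolding dissection.simps Let_def inflation_def
    by (elim insertE emptyE; simp only: move_pose_triangle move_pose_rhombus v)
      (simp_all add: rhombus_def triangle_def insert_commute)
qed

text \<open>The same for the reflection in the long diagonal; the remaining reflection is the
  composition of the two.\<close>

lemma dissection_Rhombus_mirror_vertices:
  shows
    "pose (-1) (Complex hsq hsq) ((1 + sqrt 2) *\<^sub>R 0) (Complex 0 0) = Complex 0 0"
    "pose (-1) (Complex hsq hsq) ((1 + sqrt 2) *\<^sub>R 0) (Complex 1 0) = Complex hsq hsq"
    "pose (-1) (Complex hsq hsq) ((1 + sqrt 2) *\<^sub>R 0) (Complex (1 + hsq) hsq) = Complex (1 + hsq) hsq"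
    "pose (-1) (Complex hsq hsq) ((1 + sqrt 2) *\<^sub>R 0) (Complex hsq hsq) = Complex 1 0"
    "pose (-1) (Complex hsq hsq) ((1 + sqrt 2) *\<^sub>R 0) (Complex (1 + sqrt 2) 0) = Complex (1 + hsq) (1 + hsq)"
    "pose (-1) (Complex hsq hsq) ((1 + sqrt 2) *\<^sub>R 0) (Complex (1 + sqrt 2) 1) = Complex (1 + sqrt 2) 1"
    "pose (-1) (Complex hsq hsq) ((1 + sqrt 2) *\<^sub>R 0) (Complex (1 + hsq) (1 + hsq)) = Complex (1 + sqrt 2) 0"
    "pose (-1) (Complex hsq hsq) ((1 + sqrt 2) *\<^sub>R 0) (Complex (1 + sqrt 2 + 1) 1) = Complex (1 + 3 * hsq) (1 + hsq)"
    "pose (-1) (Complex hsq hsq) ((1 + sqrt 2) *\<^sub>R 0) (Complex (2 + 3 * hsq) (1 + hsq)) = Complex (2 + 3 * hsq) (1 + hsq)"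
    "pose (-1) (Complex hsq hsq) ((1 + sqrt 2) *\<^sub>R 0) (Complex (1 + 3 * hsq) (1 + hsq)) = Complex (1 + sqrt 2 + 1) 1"
  by (simp_all add: pose_def complex_eq_iff algebra_simps add_divide_distrib)

lemma dissection_Rhombus_mirror_symmetric:
  assumes "d \<in> dissection Rhombus"
  shows "move (pose (-1) (Complex hsq hsq) (inflation *\<^sub>R 0)) d \<in> dissection Rhombus"
proof -
  note v = dissection_Rhombus_mirror_vertices
  show ?thesis
    using assms unfolding dissection.simps Let_def inflation_def
    by (elim insertE emptyE; simp only: move_pose_triangle move_pose_rhombus v)
      (simp_all add: rhombus_def triangle_def insert_commute)
qed

lemma dissection_Rhombus_symmetric:
  assumes "(e, u, c) \<in> {(1, -1, Complex (1 + hsq) hsq), (-1, Complex hsq hsq, 0),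
    (-1, - Complex hsq hsq, Complex (1 + hsq) hsq)}"
    and "d \<in> dissection Rhombus"
  shows "move (pose e u (inflation *\<^sub>R c)) d \<in> dissection Rhombus"
proof -
  have "pose (-1) (- Complex hsq hsq) (inflation *\<^sub>R Complex (1 + hsq) hsq) =
      pose 1 (-1) (inflation *\<^sub>R Complex (1 + hsq) hsq) \<circ> pose (-1) (Complex hsq hsq) (inflation *\<^sub>R 0)"
    by (simp add: fun_eq_iff pose_def complex_eq_iff)
  then have "move (pose (-1) (- Complex hsq hsq) (inflation *\<^sub>R Complex (1 + hsq) hsq)) d \<in> dissection Rhombus"
    using assms(2) dissection_Rhombus_point_symmetric dissection_Rhombus_mirror_symmetric
    by (metis move_move)
  then show ?thesis
    using assms dissection_Rhombus_point_symmetric dissection_Rhombus_mirror_symmetric by blast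
qed

text \<open>One pose composed with the inverse of the other stabilises the prototile, and the
  presence of an arrow reveals the shape. This shows that notions defined through a pose depend on
  the tile alone.\<close>

lemma same_tile:
  assumes "frame e u" "frame e' u'"
    and eq: "move (pose e u c) (prototile p) = move (pose e' u' c') (prototile p')"
  obtains e0 u0 c0 where "p' = p" "frame e0 u0" "pose e' u' c' = pose e u c \<circ> pose e0 u0 c0"
    "(e0, u0, c0) = (1, 1, 0) \<or> p = Rhombus \<and> (e0, u0, c0) \<in> {(1, -1, Complex (1 + hsq) hsq),
      (-1, Complex hsq hsq, 0), (-1, - Complex hsq hsq, Complex (1 + hsq) hsq)}"
proof -
  have p: "p' = p"
    using arg_cong[OF eq, of arrow]
    by (cases p; cases p') (simp_all add: Let_def move_def triangle_def rhombus_def)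
  obtain u1 c1 where inv: "frame e u1" "pose e u1 c1 \<circ> pose e u c = id" "pose e u c \<circ> pose e u1 c1 = id"
    using pose_inverse[OF assms(1)] by blast
  define e0 u0 c0 where "e0 = e * e'" and "u0 = u1 * Complex (Re u') (e * Im u')" and "c0 = pose e u1 c1 c'"
  have q: "pose e0 u0 c0 = pose e u1 c1 \<circ> pose e' u' c'"
    by (simp add: e0_def u0_def c0_def pose_comp[OF inv(1)])
  have f: "frame e0 u0"
    unfolding e0_def u0_def by (rule frame_comp[OF inv(1) assms(2)])
  have *: "pose e' u' c' = pose e u c \<circ> pose e0 u0 c0"
    unfolding q by (simp add: inv(3) flip: comp_assoc)
  have st: "move (pose e0 u0 c0) (prototile p) = prototile p"
  proof -
    have "move (pose e0 u0 c0) (prototile p) = move (pose e u1 c1) (move (pose e u c) (prototile p))"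
      unfolding q eq p by (simp only: move_move)
    then show ?thesis
      by (simp add: move_move inv(2) move_id)
  qed
  have "(e0, u0, c0) = (1, 1, 0) \<or> p = Rhombus \<and> (e0, u0, c0) \<in> {(1, -1, Complex (1 + hsq) hsq),
      (-1, Complex hsq hsq, 0), (-1, - Complex hsq hsq, Complex (1 + hsq) hsq)}"
  proof (cases p)
    case Triangle
    then show ?thesis
      using triangle_stabilizer[OF f] st by blast
  next
    case Rhombus
    then have "pose e0 u0 c0 ` region (prototile Rhombus) = region (prototile Rhombus)"
      using st by (metis region_move)
    then show ?thesis
      using rhombus_stabilizer[OF f] Rhombus by blast
  qed
  then show ?thesis
    using that p f * by blast
qed

text \<open>\<open>subst_tile\<close> is a union over all poses of the tile. By
  \<open>same_tile\<close> any two of them differ by a symmetry of the prototile, which maps the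
  dissection into itself, so one pose yields the whole union.\<close>

lemma subst_tile_move:
  assumes "frame e u"
  shows "subst_tile (move (pose e u c) (prototile p)) = move (pose e u (inflation *\<^sub>R c)) ` dissection p"
proof
  show "move (pose e u (inflation *\<^sub>R c)) ` dissection p \<subseteq> subst_tile (move (pose e u c) (prototile p))"
  proof
    fix t assume "t \<in> move (pose e u (inflation *\<^sub>R c)) ` dissection p"
    then have "t \<in> move (expand_isometry (pose e u c)) ` dissection p"
      by (simp only: expand_pose)
    moreover have "\<exists>f p'. move (expand_isometry (pose e u c)) ` dissection p = move (expand_isometry f) ` dissection p' \<and>
        isometry f \<and> move (pose e u c) (prototile p) = move f (prototile p')"
      using isometry_pose[OF assms] by (intro exI[of _ "pose e u c"] exI[of _ p] conjI refl)
    ultimately show "t \<in> subst_tile (move (pose e u c) (prototile p))"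
      unfolding subst_tile_def by (intro UnionI CollectI)
  qed
  show "subst_tile (move (pose e u c) (prototile p)) \<subseteq> move (pose e u (inflation *\<^sub>R c)) ` dissection p"
  proof
    fix t assume "t \<in> subst_tile (move (pose e u c) (prototile p))"
    then obtain f p' d where f: "isometry f" "move (pose e u c) (prototile p) = move f (prototile p')"
      and d: "d \<in> dissection p'" "t = move (expand_isometry f) d"
      unfolding subst_tile_def by blast
    obtain e' u' c' where f': "frame e' u'" "f = pose e' u' c'"
      using isometry_is_pose[OF f(1)] .
    obtain e0 u0 c0 where s: "p' = p" "frame e0 u0" "pose e' u' c' = pose e u c \<circ> pose e0 u0 c0"
      "(e0, u0, c0) = (1, 1, 0) \<or> p = Rhombus \<and> (e0, u0, c0) \<in> {(1, -1, Complex (1 + hsq) hsq),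
        (-1, Complex hsq hsq, 0), (-1, - Complex hsq hsq, Complex (1 + hsq) hsq)}"
      using same_tile[OF assms f'(1)] f(2) f'(2) by metis
    have "expand_isometry f = expand_isometry (pose e u c) \<circ> expand_isometry (pose e0 u0 c0)"
      using inflation_pos by (simp add: f'(2) s(3) expand_isometry_def fun_eq_iff)
    then have "t = move (pose e u (inflation *\<^sub>R c)) (move (pose e0 u0 (inflation *\<^sub>R c0)) d)"
      using d(2) by (simp add: expand_pose move_move)
    moreover have "move (pose e0 u0 (inflation *\<^sub>R c0)) d \<in> dissection p"
      using s(1,4) d(1) dissection_Rhombus_symmetric[of e0 u0 c0 d] by (auto simp: pose_id move_id)
    ultimately show "t \<in> move (pose e u (inflation *\<^sub>R c)) ` dissection p"
      by blast
  qed
qed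

section \<open>The value of a tile\<close>

definition shape_sign :: "shape \<Rightarrow> complex" where
  "shape_sign p = (case p of Triangle \<Rightarrow> -1 | Rhombus \<Rightarrow> 1)"

text \<open>\<open>u\<close> is the direction of the first edge of the moved prototile. For a
  triangle this is the hypotenuse, hence the minus sign in \<open>shape_sign\<close>. This is a
  relation because a rhombus has several poses.\<close>

definition has_colour :: "tile \<Rightarrow> complex \<Rightarrow> bool" where
  "has_colour t k \<longleftrightarrow> (\<exists>e u c p. frame e u \<and> t = move (pose e u c) (prototile p) \<and>
     k = e * shape_sign p * u ^ 4)"

lemma Complex_power4:
  "Complex x y ^ 4 = Complex ((x * x - y * y)\<^sup>2 - (2 * x * y)\<^sup>2) (2 * (x * x - y * y) * (2 * x * y))"
proof -
  have "Complex x y ^ 4 = (Complex x y * Complex x y) * (Complex x y * Complex x y)"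
    by (simp add: eval_nat_numeral mult.assoc)
  then show ?thesis
    by (simp add: complex_eq_iff power2_eq_square algebra_simps)
qed

text \<open>Only the symmetries of the rhombus matter. The half turn has \<open>u = -1\<close>, with
  fourth power \<open>1\<close>; in a reflection the change of \<open>e\<close> is compensated by
  the fourth power of \<open>Complex hsq hsq\<close>, which is \<open>-1\<close>.\<close>

lemma has_colour_unique:
  assumes "has_colour t k" "has_colour t k'"
  shows "k = k'"
proof -
  obtain e u c p where 1: "frame e u" "t = move (pose e u c) (prototile p)" "k = e * shape_sign p * u ^ 4"
    using assms(1) unfolding has_colour_def by blast
  obtain e' u' c' p' where 2: "frame e' u'" "t = move (pose e' u' c') (prototile p')" "k' = e' * shape_sign p' * u' ^ 4"
    using assms(2) unfolding has_colour_def by blast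
  have "move (pose e u c) (prototile p) = move (pose e' u' c') (prototile p')"
    using 1 2 by simp
  from same_tile[OF 1(1) 2(1) this] obtain e0 u0 c0 where s: "p' = p" "frame e0 u0"
    "pose e' u' c' = pose e u c \<circ> pose e0 u0 c0"
    "(e0, u0, c0) = (1, 1, 0) \<or> p = Rhombus \<and> (e0, u0, c0) \<in> {(1, -1, Complex (1 + hsq) hsq),
        (-1, Complex hsq hsq, 0), (-1, - Complex hsq hsq, Complex (1 + hsq) hsq)}"
    by metis
  have e: "e' = e * e0" "u' = u * Complex (Re u0) (e * Im u0)"
    using pose_eqD[OF 2(1) s(3)[unfolded pose_comp[OF 1(1)]]] by simp_all
  have pm: "e = 1 \<or> e = -1"
    using 1(1) by (simp add: frame_def)
  have "Complex hsq (e * hsq) ^ 4 = -1" "Complex (- hsq) (- (e * hsq)) ^ 4 = -1"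
    "Complex (-1) 0 ^ 4 = 1"
    using pm by (auto simp: Complex_power4 complex_eq_iff)
  then have "e0 * Complex (Re u0) (e * Im u0) ^ 4 = 1"
    using s(4) by (auto simp: one_complex.ctr[symmetric] Complex_eq_neg_1[symmetric])
  then show ?thesis
    unfolding 1(3) 2(3) e s(1) by (simp add: power_mult_distrib)
qed

definition edge_colour :: "complex \<Rightarrow> complex" where
  "edge_colour v = (if norm v = 1 then v ^ 4 else - (v ^ 4) / 4)"

text \<open>Once the pose is factored out, only the four edges in \<open>proto_edges\<close> remain
  to be computed; \<open>w\<close> is such an edge, reflected if \<open>s = -1\<close>.\<close>

lemma has_colour_edge:
  assumes "has_edge t a b s"
  shows "has_colour t (s * edge_colour (b - a))"
  using assms
proof (cases rule: has_edge_cases)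
  case (1 u c p a0 b0)
  have ba: "b - a = u * Complex (Re (b0 - a0)) (s * Im (b0 - a0))"
    unfolding 1 pose_diff ..
  have n: "norm (b - a) = norm (b0 - a0)"
    unfolding 1 by (rule norm_pose_diff[OF 1(1)])
  have s: "s = 1 \<or> s = -1"
    using 1(1) by (simp add: frame_def)
  define w where "w = Complex (Re (b0 - a0)) (s * Im (b0 - a0))"
  have "(if norm (b0 - a0) = 1 then w ^ 4 else - (w ^ 4) / 4) = shape_sign p"
  proof -
    consider (a) "p = Triangle" "a0 = 0" "b0 = Complex (sqrt 2) 0"
      | (b) "p = Triangle" "a0 = Complex (sqrt 2) 0" "b0 = Complex hsq hsq"
      | (c) "p = Triangle" "a0 = Complex hsq hsq" "b0 = 0"
      | (d) "p = Rhombus" "a0 = 0" "b0 = 1"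
      using 1(2) by (cases p) auto
    then show ?thesis
    proof cases
      case a
      show ?thesis
        using s unfolding a w_def shape_sign_def Complex_power4
        by (auto simp: cmod_def complex_eq_iff power2_eq_square)
    next
      case b
      show ?thesis
        using s unfolding b w_def shape_sign_def Complex_power4
        by (auto simp: cmod_def complex_eq_iff power2_eq_square)
    next
      case c
      show ?thesis
        using s unfolding c w_def shape_sign_def Complex_power4
        by (auto simp: cmod_def complex_eq_iff power2_eq_square)
    next
      case d
      show ?thesis
        using s unfolding d w_def shape_sign_def Complex_power4
        by (auto simp: cmod_def complex_eq_iff power2_eq_square)
    qed
  qed
  from this[symmetric] have "edge_colour (b - a) = shape_sign p * u ^ 4"
    unfolding edge_colour_def n unfolding ba w_def[symmetric] power_mult_distrib
    by simp
  then have "s * edge_colour (b - a) = s * shape_sign p * u ^ 4"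
    by (simp only: mult.assoc)
  then show ?thesis
    unfolding has_colour_def using 1(1,3) by blast
qed

section \<open>Inflation preserves compatibility\<close>

lemma congruent_copy_iff:
  "congruent_copy t \<longleftrightarrow> (\<exists>e u c p. frame e u \<and> t = move (pose e u c) (prototile p))"
  unfolding congruent_copy_def by (metis isometry_is_pose isometry_pose)

lemma congruent_copy_move: "frame e u \<Longrightarrow> congruent_copy t \<Longrightarrow> congruent_copy (move (pose e u c) t)"
  unfolding congruent_copy_iff by (metis move_move pose_comp frame_comp)

lemma pose_scaled: "pose e u (l *\<^sub>R c) (l *\<^sub>R z) = l *\<^sub>R pose e u c z"
  by (simp add: pose_def complex_eq_iff algebra_simps)

lemma subst_tile_cases:
  assumes "frame e u" "t \<in> subst_tile (move (pose e u c) (prototile p))"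
  obtains d where "d \<in> dissection p" "t = move (pose e u (inflation *\<^sub>R c)) d"
  using assms by (auto simp: subst_tile_move)

lemma subst_tile_congruent:
  assumes "congruent_copy t" "t' \<in> subst_tile t"
  shows "congruent_copy t'"
proof -
  obtain e u c p where t: "frame e u" "t = move (pose e u c) (prototile p)"
    using assms(1) unfolding congruent_copy_iff by blast
  obtain d where d: "d \<in> dissection p" "t' = move (pose e u (inflation *\<^sub>R c)) d"
    using subst_tile_cases t assms(2) by metis
  have "congruent_copy d"
    using d(1) by (metis dissection_has_edge tile_of_edge congruent_copy_iff)
  then show ?thesis
    using congruent_copy_move t(1) d(2) by blast
qed

lemma subst_tile_subset:
  assumes "congruent_copy t" "t' \<in> subst_tile t" "z \<in> region t'"
  shows "z /\<^sub>R inflation \<in> region t"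
proof -
  obtain e u c p where t: "frame e u" "t = move (pose e u c) (prototile p)"
    using assms(1) unfolding congruent_copy_iff by blast
  obtain d where d: "d \<in> dissection p" "t' = move (pose e u (inflation *\<^sub>R c)) d"
    using subst_tile_cases t assms(2) by metis
  obtain w where w: "w \<in> region d" "z = pose e u (inflation *\<^sub>R c) w"
    using assms(3) d(2) by (auto simp: region_move)
  have "z = inflation *\<^sub>R pose e u c (w /\<^sub>R inflation)"
    using inflation_pos by (simp add: w(2) flip: pose_scaled)
  then show ?thesis
    using dissection_subset[OF d(1) w(1)] inflation_pos by (simp add: t(2) region_move)
qed

lemma subedges_pose:
  assumes "frame e u" "(a', b', k) \<in> subedges a b"
  shows "(pose e u (inflation *\<^sub>R c) a', pose e u (inflation *\<^sub>R c) b', k) \<in> subedges (pose e u c a) (pose e u c b)"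
proof -
  let ?P = "pose e u (inflation *\<^sub>R c)"
  define v where "v = sgn (b - a)"
  define w where "w = sgn (pose e u c b - pose e u c a)"
  have n: "norm (pose e u c b - pose e u c a) = norm (b - a)"
    by (rule norm_pose_diff[OF assms(1)])
  have w: "w = u * Complex (Re v) (e * Im v)"
    unfolding w_def v_def sgn_div_norm n unfolding pose_diff by (simp add: complex_eq_iff algebra_simps)
  have 1: "?P (inflation *\<^sub>R z + v) = inflation *\<^sub>R pose e u c z + w" for z
    unfolding w by (simp add: pose_def complex_eq_iff algebra_simps)
  have 2: "?P (inflation *\<^sub>R z - v) = inflation *\<^sub>R pose e u c z - w" for z
    unfolding w by (simp add: pose_def complex_eq_iff algebra_simps)
  show ?thesis
    using assms(2) unfolding subedges_def Let_def n v_def[symmetric] w_def[symmetric]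
    by (auto simp: 1 2 pose_scaled split: if_splits)
qed

lemma dissection_refines:
  "(a, b) \<in> proto_edges p \<Longrightarrow> d \<in> dissection p \<Longrightarrow> refines a b d"
  by (cases p) (simp_all only: dissection_Triangle_refines dissection_Rhombus_refines)

text \<open>\<open>refines\<close> carried over to an arbitrary pose; a reflection exchanges the
  sides of every edge, hence the factors \<open>s\<close>.\<close>

lemma subst_tile_edge:
  assumes "has_edge t a b s" "t' \<in> subst_tile t"
  shows "(\<exists>(a', b', k) \<in> subedges a b. has_edge t' a' b' (s * k)) \<or>
    (\<exists>q. \<forall>z\<in>region t'. s * side a b (z /\<^sub>R inflation) \<le> 0 \<longrightarrow> z = q)"
  using assms(1)
proof (cases rule: has_edge_cases)
  case (1 u c p a0 b0)
  let ?P = "pose s u (inflation *\<^sub>R c)"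
  obtain d where d: "d \<in> dissection p" "t' = move ?P d"
    using subst_tile_cases 1(1,3) assms(2) by metis
  have s: "s * s = 1"
    using frame_square[OF 1(1)] .
  consider a' b' k where "(a', b', k) \<in> subedges a0 b0" "has_edge d a' b' k"
    | q where "\<forall>z\<in>region d. side a0 b0 (z /\<^sub>R inflation) \<le> 0 \<longrightarrow> z = q"
    using dissection_refines[OF 1(2) d(1)] unfolding refines_def by blast
  then show ?thesis
  proof cases
    case (1 a' b' k)
    have "(?P a', ?P b', k) \<in> subedges a b"
      unfolding \<open>a = _\<close> \<open>b = _\<close> by (rule subedges_pose) fact+
    moreover have "has_edge t' (?P a') (?P b') (s * k)"
      unfolding d(2) by (rule has_edge_move) fact+
    ultimately show ?thesis
      by blast
  next
    case (2 q)
    have "z = ?P q" if z: "z \<in> region t'" "s * side a b (z /\<^sub>R inflation) \<le> 0" for z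
    proof -
      obtain w where w: "w \<in> region d" "z = ?P w"
        using z(1) d(2) by (auto simp: region_move)
      have "z = inflation *\<^sub>R pose s u c (w /\<^sub>R inflation)"
        using inflation_pos by (simp add: w(2) flip: pose_scaled)
      then have "side a b (z /\<^sub>R inflation) = s * side a0 b0 (w /\<^sub>R inflation)"
        using inflation_pos side_pose[OF 1(1)] by (simp add: 1(4,5))
      then have "side a0 b0 (w /\<^sub>R inflation) \<le> 0"
        using z(2) s by (simp flip: mult.assoc)
      then show ?thesis
        using 2 w by simp
    qed
    then show ?thesis
      by blast
  qed
qed

section \<open>Overlaps among the pieces of an inflated edge\<close>

lemma segments_meet_once:
  fixes d x0 :: complex
  assumes "d \<noteq> 0" "s \<le> m" "s' \<le> m" "m \<le> t" "m \<le> t'"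
    and "x \<in> closed_segment (x0 + s *\<^sub>R d) (x0 + s' *\<^sub>R d)" "x \<in> closed_segment (x0 + t *\<^sub>R d) (x0 + t' *\<^sub>R d)"
  shows "x = x0 + m *\<^sub>R d"
proof (rule separated_meet_once[where n = d])
  have *: "d \<bullet> (x0 + r *\<^sub>R d - (x0 + m *\<^sub>R d)) = (r - m) * (d \<bullet> d)" for r
    by (simp add: inner_diff_right inner_add_right algebra_simps)
  have "0 < d \<bullet> d"
    using assms(1) by simp
  then show "\<forall>v\<in>{x0 + t *\<^sub>R d, x0 + t' *\<^sub>R d}. v = x0 + m *\<^sub>R d \<or> 0 < d \<bullet> (v - (x0 + m *\<^sub>R d))"
    using assms(4,5) unfolding ball_simps * by (auto simp: zero_less_mult_iff less_le)
  show "\<forall>v\<in>{x0 + s *\<^sub>R d, x0 + s' *\<^sub>R d}. d \<bullet> (v - (x0 + m *\<^sub>R d)) \<le> 0"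
    using assms(2,3) \<open>0 < d \<bullet> d\<close> unfolding ball_simps * by (auto simp: mult_le_0_iff)
  show "x \<in> convex hull {x0 + t *\<^sub>R d, x0 + t' *\<^sub>R d} \<inter> convex hull {x0 + s *\<^sub>R d, x0 + s' *\<^sub>R d}"
    using assms(6,7) by (simp flip: segment_convex_hull)
qed

text \<open>The pieces of \<open>subedges\<close> as parameters along the unit direction, so that
  overlaps become comparisons of real intervals.\<close>

definition subdivision :: "complex \<Rightarrow> (real \<times> real \<times> real) set" where
  "subdivision v = (if norm v = 1 then {(0, 1, 1), (1, 1 + sqrt 2, 1)}
     else {(0, 1, 1), (1 + sqrt 2, 1, -1), (2 + sqrt 2, 1 + sqrt 2, -1)})"

lemma subedges_eq_subdivision:
  assumes "norm (b - a) = 1 \<or> norm (b - a) = sqrt 2"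
  shows "subedges a b = (\<lambda>(s, t, k). (inflation *\<^sub>R a + s *\<^sub>R sgn (b - a), inflation *\<^sub>R a + t *\<^sub>R sgn (b - a), k)) `
    subdivision (b - a)"
proof -
  have b: "inflation *\<^sub>R b = inflation *\<^sub>R a + (inflation * norm (b - a)) *\<^sub>R sgn (b - a)"
  proof -
    have "norm (b - a) *\<^sub>R sgn (b - a) = b - a"
      by (cases "b = a") (simp_all add: sgn_div_norm)
    then show ?thesis
      by (simp only: scaleR_scaleR[symmetric]) (simp add: algebra_simps)
  qed
  have i: "inflation * sqrt 2 = 2 + sqrt 2"
    by (simp add: inflation_def algebra_simps)
  consider "norm (b - a) = 1" | "norm (b - a) = sqrt 2"
    using assms by blast
  then show ?thesis
  proof cases
    case 1
    then show ?thesis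
      unfolding subedges_def subdivision_def Let_def b by (simp add: inflation_def)
  next
    case 2
    have e: "inflation *\<^sub>R a + (2 + sqrt 2) *\<^sub>R sgn (b - a) - sgn (b - a) = inflation *\<^sub>R a + (1 + sqrt 2) *\<^sub>R sgn (b - a)"
      by (simp add: scaleR_conv_of_real algebra_simps)
    then show ?thesis
      using sqrt_2_bounds unfolding subedges_def subdivision_def Let_def b 2 i e by simp
  qed
qed

lemma subdivision_ordered:
  assumes "(s, t, k) \<in> subdivision v" "(s', t', k') \<in> subdivision v" "(s, t, k) \<noteq> (s', t', k')"
  shows "(\<exists>m. s \<le> m \<and> t \<le> m \<and> m \<le> s' \<and> m \<le> t') \<or> (\<exists>m. s' \<le> m \<and> t' \<le> m \<and> m \<le> s \<and> m \<le> t)"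
proof -
  have "max s t \<le> min s' t' \<or> max s' t' \<le> min s t"
  proof (cases "norm v = 1")
    case True
    have "(s, t, k) \<in> {(0, 1, 1), (1, 1 + sqrt 2, 1)}" "(s', t', k') \<in> {(0, 1, 1), (1, 1 + sqrt 2, 1)}"
      using assms(1,2) True unfolding subdivision_def by simp_all
    then show ?thesis
      by (elim insertE emptyE Pair_inject; use assms(3) sqrt_2_bounds in simp)
  next
    case False
    have "(s, t, k) \<in> {(0, 1, 1), (1 + sqrt 2, 1, -1), (2 + sqrt 2, 1 + sqrt 2, -1)}"
      "(s', t', k') \<in> {(0, 1, 1), (1 + sqrt 2, 1, -1), (2 + sqrt 2, 1 + sqrt 2, -1)}"
      using assms(1,2) False unfolding subdivision_def by simp_all
    then show ?thesis
      by (elim insertE emptyE Pair_inject; use assms(3) sqrt_2_bounds in simp)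
  qed
  then show ?thesis
  proof
    assume "max s t \<le> min s' t'"
    then show ?thesis
      by (intro disjI1 exI[of _ "max s t"]) auto
  next
    assume "max s' t' \<le> min s t"
    then show ?thesis
      by (intro disjI2 exI[of _ "max s' t'"]) auto
  qed
qed

lemma subedges_overlap:
  assumes "norm (b - a) = 1 \<or> norm (b - a) = sqrt 2"
    and "(a1, b1, k1) \<in> subedges a b" "(a2, b2, k2) \<in> subedges a b"
    and "x \<in> closed_segment a1 b1 \<inter> closed_segment a2 b2" "y \<in> closed_segment a1 b1 \<inter> closed_segment a2 b2" "x \<noteq> y"
  shows "(a1, b1, k1) = (a2, b2, k2)"
proof (rule ccontr)
  assume ne: "(a1, b1, k1) \<noteq> (a2, b2, k2)"
  let ?P = "\<lambda>r. inflation *\<^sub>R a + r *\<^sub>R sgn (b - a)"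
  have d: "sgn (b - a) \<noteq> 0"
    using assms(1) by (auto simp: sgn_zero_iff)
  obtain s t where 1: "(s, t, k1) \<in> subdivision (b - a)" "a1 = ?P s" "b1 = ?P t"
    using assms(2) unfolding subedges_eq_subdivision[OF assms(1)] by auto
  obtain s' t' where 2: "(s', t', k2) \<in> subdivision (b - a)" "a2 = ?P s'" "b2 = ?P t'"
    using assms(3) unfolding subedges_eq_subdivision[OF assms(1)] by auto
  have "(s, t, k1) \<noteq> (s', t', k2)"
    using ne 1 2 by auto
  then obtain m where "(s \<le> m \<and> t \<le> m \<and> m \<le> s' \<and> m \<le> t') \<or> (s' \<le> m \<and> t' \<le> m \<and> m \<le> s \<and> m \<le> t)"
    using subdivision_ordered[OF 1(1) 2(1)] by blast
  then have "z = ?P m" if "z \<in> closed_segment a1 b1 \<inter> closed_segment a2 b2" for z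
    using segments_meet_once[OF d] that unfolding 1 2 by blast
  then show False
    using assms(4-6) by metis
qed

lemma has_edge_norm:
  assumes "has_edge t a b s"
  shows "norm (b - a) = 1 \<or> norm (b - a) = sqrt 2"
  using assms
proof (cases rule: has_edge_cases)
  case (1 u c p a0 b0)
  have "norm (b - a) = norm (b0 - a0)"
    unfolding 1 by (rule norm_pose_diff[OF 1(1)])
  then show ?thesis
    using 1(2) by (cases p) (auto simp: cmod_def power2_eq_square)
qed

lemma subedges_side:
  assumes "norm (b - a) = 1 \<or> norm (b - a) = sqrt 2"
    and "(a', b', k) \<in> subedges a b" "side a b (z /\<^sub>R inflation) = 0"
  shows "side a' b' z = 0"
proof -
  let ?d = "sgn (b - a)"
  obtain s t where st: "a' = inflation *\<^sub>R a + s *\<^sub>R ?d" "b' = inflation *\<^sub>R a + t *\<^sub>R ?d"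
    using assms(2) unfolding subedges_eq_subdivision[OF assms(1)] by auto
  have "(\<i> * (b - a)) \<bullet> (z - inflation *\<^sub>R a) = inflation * side a b (z /\<^sub>R inflation)"
  proof -
    have "z - inflation *\<^sub>R a = inflation *\<^sub>R (z /\<^sub>R inflation - a)"
      using inflation_pos by (simp add: scaleR_diff_right)
    then show ?thesis
      by (simp only: side_def inner_scaleR_right)
  qed
  then have "(\<i> * ?d) \<bullet> (z - inflation *\<^sub>R a) = 0"
    using assms(3) by (simp add: sgn_div_norm)
  moreover have "\<i> * (b' - a') = (t - s) *\<^sub>R (\<i> * ?d)"
    unfolding st by (simp add: algebra_simps)
  moreover have "(\<i> * ?d) \<bullet> (z - a') = (\<i> * ?d) \<bullet> (z - inflation *\<^sub>R a)"
  proof -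
    have "(\<i> * w) \<bullet> w = 0" for w
      by (simp add: inner_complex_def)
    then show ?thesis
      unfolding st by (simp add: inner_diff_right inner_add_right)
  qed
  ultimately show ?thesis
    unfolding side_def by simp
qed

lemma compatible_move:
  assumes "frame e u" "compatible s t"
  shows "compatible (move (pose e u c) s) (move (pose e u c) t)"
proof -
  consider "\<forall>x y. x \<in> region s \<inter> region t \<longrightarrow> y \<in> region s \<inter> region t \<longrightarrow> x = y"
    | a b k where "has_edge s a b k" "has_edge t a b (- k)"
    using assms(2) unfolding compatible_def by blast
  then show ?thesis
  proof cases
    case 1
    moreover have "region (move (pose e u c) s) \<inter> region (move (pose e u c) t) = pose e u c ` (region s \<inter> region t)"
      unfolding region_move by (rule image_Int[symmetric, OF inj_pose[OF assms(1)]])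
    ultimately show ?thesis
      unfolding compatible_def by (metis imageE)
  next
    case 2
    then show ?thesis
      using compatible_if_matched[OF has_edge_move[OF assms(1) 2(1)] has_edge_move[OF assms(1) 2(2)]]
      by simp
  qed
qed

lemma dissection_compatible:
  "s \<in> dissection p \<Longrightarrow> t \<in> dissection p \<Longrightarrow> s \<noteq> t \<Longrightarrow> compatible s t"
  by (cases p) (use dissection_Triangle_compatible dissection_Rhombus_compatible in blast)+

text \<open>The induction step. Two common points of children of different parents shrink to two
  common points of the parents, which therefore share a directed edge. Being on opposite sides
  forces all common points onto its line, so each child has a piece of the subdivided edge as an
  edge. Pieces with two common points coincide, and the signs remain opposite.\<close>

lemma subst_tiles_compatible:
  assumes "congruent_copy s" "congruent_copy t" "s \<noteq> t \<Longrightarrow> compatible s t"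
    and "s' \<in> subst_tile s" "t' \<in> subst_tile t" "s' \<noteq> t'"
  shows "compatible s' t'"
proof (cases "s = t")
  case True
  obtain e u c p where t: "frame e u" "t = move (pose e u c) (prototile p)"
    using assms(2) unfolding congruent_copy_iff by blast
  show ?thesis
    using subst_tile_cases[OF t(1)] assms(4-6) dissection_compatible compatible_move[OF t(1)]
    unfolding True t(2) by metis
next
  case False
  show ?thesis
  proof (rule ccontr)
    assume nc: "\<not> compatible s' t'"
    then obtain x y where xy: "x \<in> region s' \<inter> region t'" "y \<in> region s' \<inter> region t'" "x \<noteq> y"
      unfolding compatible_def by blast
    have in_both: "z /\<^sub>R inflation \<in> region s \<inter> region t" if "z \<in> region s' \<inter> region t'" for z
      using that assms(1,2,4,5) subst_tile_subset by blast
    have "x /\<^sub>R inflation \<noteq> y /\<^sub>R inflation"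
      using xy(3) inflation_pos by simp
    then obtain a b k where e: "has_edge s a b k" "has_edge t a b (- k)"
      using assms(3)[OF False] in_both xy unfolding compatible_def by metis
    have side0: "side a b (z /\<^sub>R inflation) = 0" if "z \<in> region s' \<inter> region t'" for z
      using has_edge_side[OF e(1), of "z /\<^sub>R inflation"] has_edge_side[OF e(2), of "z /\<^sub>R inflation"]
        in_both[OF that] side_segment by force
    \<comment> \<open>At most one of \<open>x\<close> and \<open>y\<close> equals \<open>q\<close>,
      so the touching alternative of \<open>subst_tile_edge\<close> fails for both children.\<close>
    have many: "\<exists>z\<in>region s'. k' * side a b (z /\<^sub>R inflation) \<le> 0 \<and> z \<noteq> q"
        "\<exists>z\<in>region t'. k' * side a b (z /\<^sub>R inflation) \<le> 0 \<and> z \<noteq> q" for k' q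
      by (cases "x = q"; use xy side0[OF xy(1)] side0[OF xy(2)] in force)+
    obtain a1 b1 k1 where 1: "(a1, b1, k1) \<in> subedges a b" "has_edge s' a1 b1 (k * k1)"
      using subst_tile_edge[OF e(1) assms(4)] many(1) by blast
    obtain a2 b2 k2 where 2: "(a2, b2, k2) \<in> subedges a b" "has_edge t' a2 b2 (- k * k2)"
      using subst_tile_edge[OF e(2) assms(5)] many(2) by blast
    \<comment> \<open>A common point is on the line of each piece, hence by
      \<open>has_edge_side\<close> in the piece itself.\<close>
    have "z \<in> closed_segment a1 b1 \<inter> closed_segment a2 b2" if "z \<in> region s' \<inter> region t'" for z
      using that has_edge_side[OF 1(2), of z] has_edge_side[OF 2(2), of z]
        subedges_side[OF has_edge_norm[OF e(1)] _ side0] 1(1) 2(1) by force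
    then have "(a1, b1, k1) = (a2, b2, k2)"
      using subedges_overlap[OF has_edge_norm[OF e(1)] 1(1) 2(1)] xy by metis
    then show False
      using nc compatible_if_matched[OF 1(2)] 2(2) by simp
  qed
qed

section \<open>Only two values within a supertile\<close>

lemma has_colour_move:
  assumes "frame e u" "has_colour t k"
  shows "has_colour (move (pose e u c) t) (e * u ^ 4 * Complex (Re k) (e * Im k))"
proof -
  obtain e' u' c' p where 1: "frame e' u'" "t = move (pose e' u' c') (prototile p)" "k = e' * shape_sign p * u' ^ 4"
    using assms(2) unfolding has_colour_def by blast
  have conj: "Complex (Re (x * y)) (e * Im (x * y)) = Complex (Re x) (e * Im x) * Complex (Re y) (e * Im y)" for x y
    using assms(1) by (auto simp: frame_def complex_eq_iff algebra_simps)
  have "z ^ 4 = z * (z * (z * z))" for z :: complex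
    by (simp add: eval_nat_numeral)
  then have "Complex (Re (v ^ 4)) (e * Im (v ^ 4)) = Complex (Re v) (e * Im v) ^ 4" for v
    by (simp only: conj)
  moreover have "Complex (Re (shape_sign p)) (e * Im (shape_sign p)) = shape_sign p"
    by (cases p) (auto simp: shape_sign_def complex_eq_iff)
  moreover have "Complex (Re (complex_of_real e')) (e * Im (complex_of_real e')) = e'"
    by (simp add: complex_eq_iff)
  ultimately have "Complex (Re k) (e * Im k) = e' * shape_sign p * Complex (Re u') (e * Im u') ^ 4"
    unfolding 1(3) conj by simp
  then have "e * u ^ 4 * Complex (Re k) (e * Im k) =
      complex_of_real (e * e') * shape_sign p * (u * Complex (Re u') (e * Im u')) ^ 4"
    by (simp add: power_mult_distrib)
  then show ?thesis
    unfolding has_colour_def 1(2) move_move pose_comp[OF assms(1)]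
    using frame_comp[OF assms(1) 1(1)] by blast
qed

text \<open>A pose multiplies values by \<open>e * u ^ 4\<close>, after conjugating them if
  \<open>e = -1\<close>; conjugation fixes \<open>1\<close> and \<open>-1\<close>.\<close>

lemma has_colour_move_sign:
  assumes "frame e u" "has_colour t 1 \<or> has_colour t (-1)"
  shows "has_colour (move (pose e u c) t) (e * u ^ 4) \<or> has_colour (move (pose e u c) t) (- (e * u ^ 4))"
proof -
  have "Complex (Re 1) (e * Im 1) = 1" "Complex (Re (-1)) (e * Im (-1)) = -1"
    by (simp_all add: complex_eq_iff)
  then show ?thesis
    using assms(2) has_colour_move[OF assms(1), of t 1 c] has_colour_move[OF assms(1), of t "-1" c] by auto
qed

lemma right_isosceles_colour:
  assumes "right_isosceles s t h x" "(h - t) ^ 4 = 4 \<or> (h - t) ^ 4 = -4"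
  shows "has_colour (triangle t h x) 1 \<or> has_colour (triangle t h x) (-1)"
proof -
  have s: "s = 1 \<or> s = -1" and "norm (h - t) = sqrt 2"
    using assms(1) by (auto simp: right_isosceles_def cmod_def)
  then have "edge_colour (h - t) = - ((h - t) ^ 4) / 4"
    by (simp add: edge_colour_def)
  then show ?thesis
    using assms(2) s has_colour_edge[OF triangle_edges(1)[OF assms(1)]] by auto
qed

lemma unit_rhombus_colour:
  assumes "unit_rhombus s a b c d" "(b - a) ^ 4 = 1 \<or> (b - a) ^ 4 = -1"
  shows "has_colour (rhombus a b c d) 1 \<or> has_colour (rhombus a b c d) (-1)"
proof -
  have s: "s = 1 \<or> s = -1" and "norm (b - a) = 1"
    using assms(1) by (auto simp: unit_rhombus_def cmod_def)
  then have "edge_colour (b - a) = (b - a) ^ 4"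
    by (simp add: edge_colour_def)
  then show ?thesis
    using assms(2) s has_colour_edge[OF rhombus_edges(1)[OF assms(1)]] by auto
qed

text \<open>All edges point in multiples of 45 degrees, so the fourth power is \<open>1\<close> or
  \<open>-1\<close> for a unit edge and \<open>4\<close> or \<open>-4\<close> for a hypotenuse; one
  edge per tile determines the value.\<close>

lemma dissection_colour:
  assumes "d \<in> dissection p"
  shows "has_colour d 1 \<or> has_colour d (-1)"
proof (cases p)
  case Triangle
  note s = dissection_Triangle_shapes
  note c = s(1-3)[THEN right_isosceles_colour] s(4)[THEN unit_rhombus_colour]
    s(5)[THEN unit_rhombus_colour, unfolded rhombus_sym(3)[where a = "Complex (1 + sqrt 2) 0"]]
  show ?thesis
    using assms unfolding Triangle dissection.simps Let_def
    by (elim insertE emptyE)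
      (simp only:, rule c, simp add: complex_diff Complex_power4 complex_eq_iff power2_eq_square)+
next
  case Rhombus
  note s = dissection_Rhombus_shapes
  note c = s(4-7)[THEN right_isosceles_colour] s(1,3)[THEN unit_rhombus_colour]
    s(2)[THEN unit_rhombus_colour, unfolded rhombus_sym(3)[where a = "Complex (1 + hsq) hsq"]]
  show ?thesis
    using assms unfolding Rhombus dissection.simps Let_def inflation_def
    by (elim insertE emptyE)
      (simp only:, rule c, simp add: complex_diff Complex_power4 complex_eq_iff power2_eq_square)+
qed

text \<open>Recovers from the value of a tile the factor by which its pose acts, which is also the
  factor for its children.\<close>

lemma has_colour_pm_1:
  assumes "has_colour (move (pose e u c) (prototile p)) 1 \<or> has_colour (move (pose e u c) (prototile p)) (-1)" "frame e u"
  shows "complex_of_real e * u ^ 4 = 1 \<or> complex_of_real e * u ^ 4 = -1"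
proof -
  have "has_colour (move (pose e u c) (prototile p)) (e * shape_sign p * u ^ 4)"
    using assms(2) unfolding has_colour_def by blast
  then have "e * shape_sign p * u ^ 4 = 1 \<or> e * shape_sign p * u ^ 4 = -1"
    using assms(1) has_colour_unique by blast
  then show ?thesis
    by (cases p) (auto simp: shape_sign_def minus_equation_iff[of _ 1])
qed

lemma subst_tile_colour:
  assumes "congruent_copy t" "has_colour t 1 \<or> has_colour t (-1)" "t' \<in> subst_tile t"
  shows "has_colour t' 1 \<or> has_colour t' (-1)"
proof -
  obtain e u c p where t: "frame e u" "t = move (pose e u c) (prototile p)"
    using assms(1) unfolding congruent_copy_iff by blast
  obtain d where d: "d \<in> dissection p" "t' = move (pose e u (inflation *\<^sub>R c)) d"
    using subst_tile_cases t assms(3) by metis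
  have "complex_of_real e * u ^ 4 = 1 \<or> complex_of_real e * u ^ 4 = -1"
    using has_colour_pm_1 assms(2) t by blast
  then show ?thesis
    using has_colour_move_sign[OF t(1) dissection_colour[OF d(1)]] unfolding d(2) by fastforce
qed

lemma prototile_congruent: "congruent_copy (prototile p)"
  using move_id[of "prototile p"] unfolding congruent_copy_iff pose_id[symmetric]
  by (metis frame_def norm_one)

lemma prototile_colour: "has_colour (prototile p) 1 \<or> has_colour (prototile p) (-1)"
proof -
  have "has_colour (move (pose 1 1 0) (prototile p)) (complex_of_real 1 * shape_sign p * 1 ^ 4)"
    unfolding has_colour_def
    by (rule exI[of _ 1], rule exI[of _ 1], rule exI[of _ 0], rule exI[of _ p]) (simp_all add: frame_def)
  then show ?thesis
    by (cases p) (simp_all add: pose_id move_id shape_sign_def)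
qed

lemma subst_funpow_Suc:
  "t \<in> (subst ^^ Suc n) P \<longleftrightarrow> (\<exists>s\<in>(subst ^^ n) P. t \<in> subst_tile s)"
  using subst_def[of "(subst ^^ n) P"] by simp

lemma patch_tiles:
  assumes "t \<in> (subst ^^ n) {prototile p}"
  shows "congruent_copy t \<and> (has_colour t 1 \<or> has_colour t (-1))"
  using assms
proof (induction n arbitrary: t)
  case 0
  then show ?case
    using prototile_congruent prototile_colour by simp
next
  case (Suc n)
  then show ?case
    using subst_tile_congruent subst_tile_colour unfolding subst_funpow_Suc by blast
qed

lemma patch_compatible:
  assumes "s \<in> (subst ^^ n) {prototile p}" "t \<in> (subst ^^ n) {prototile p}" "s \<noteq> t"
  shows "compatible s t"
  using assms
proof (induction n arbitrary: s t)
  case 0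
  then show ?case
    by simp
next
  case (Suc n)
  then obtain s0 t0 where "s0 \<in> (subst ^^ n) {prototile p}" "t0 \<in> (subst ^^ n) {prototile p}"
    "s \<in> subst_tile s0" "t \<in> subst_tile t0"
    unfolding subst_funpow_Suc by blast
  then show ?case
    using subst_tiles_compatible[of s0 t0 s t] Suc.IH patch_tiles Suc.prems(3) by blast
qed

section \<open>Local finiteness and the lower bound\<close>

lemma region_congruent_copy:
  assumes "congruent_copy t"
  shows "convex (region t)" "compact (region t)"
proof -
  obtain e u c p where t: "t = move (pose e u c) (prototile p)"
    using assms unfolding congruent_copy_iff by blast
  have "\<exists>S. finite S \<and> region (prototile p) = convex hull S"
    by (cases p) (force simp: Let_def region_triangle region_rhombus)+
  then obtain S where "finite S" "region t = convex hull (pose e u c ` S)"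
    by (auto simp: t region_move pose_hull)
  then show "convex (region t)" "compact (region t)"
    by (simp_all add: finite_imp_compact_convex_hull)
qed

text \<open>The centre is a rational point near the incentre, and the small radius leaves room for
  crude bounds on \<open>sqrt 2\<close>.\<close>

lemma ball_proto_triangle: "ball (Complex (7/10) (3/10)) (1/10) \<subseteq> region (prototile Triangle)"
proof
  fix z assume "z \<in> ball (Complex (7/10) (3/10)) (1/10)"
  then have "\<bar>Re z - 7/10\<bar> < 1/10" "\<bar>Im z - 3/10\<bar> < 1/10"
    using abs_Re_le_cmod[of "z - Complex (7/10) (3/10)"] abs_Im_le_cmod[of "z - Complex (7/10) (3/10)"]
    by (auto simp: dist_norm norm_minus_commute)
  then show "z \<in> region (prototile Triangle)"
    using sqrt_2_bounds unfolding abs_less_iff by (intro in_proto_triangle) linarith+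
qed

lemma ball_proto_rhombus: "ball (Complex (17/20) (7/20)) (1/10) \<subseteq> region (prototile Rhombus)"
proof
  fix z assume "z \<in> ball (Complex (17/20) (7/20)) (1/10)"
  then have "\<bar>Re z - 17/20\<bar> < 1/10" "\<bar>Im z - 7/20\<bar> < 1/10"
    using abs_Re_le_cmod[of "z - Complex (17/20) (7/20)"] abs_Im_le_cmod[of "z - Complex (17/20) (7/20)"]
    by (auto simp: dist_norm norm_minus_commute)
  then show "z \<in> region (prototile Rhombus)"
    using sqrt_2_bounds unfolding abs_less_iff by (intro in_proto_rhombus) linarith+
qed

lemma tile_size:
  obtains r R :: real where "0 < r"
    "\<And>t. congruent_copy t \<Longrightarrow> \<exists>x. ball x r \<subseteq> region t \<and> region t \<subseteq> cball x R"
proof -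
  have "bounded (region (prototile Triangle) \<union> region (prototile Rhombus))"
    using compact_imp_bounded[OF region_congruent_copy(2)[OF prototile_congruent]] by (simp only: bounded_Un)
  then obtain R where R: "\<And>z w. z \<in> region (prototile Triangle) \<union> region (prototile Rhombus) \<Longrightarrow>
      w \<in> region (prototile Triangle) \<union> region (prototile Rhombus) \<Longrightarrow> dist z w \<le> R"
    unfolding bounded_two_points by blast
  have "\<exists>x. ball x (1/10) \<subseteq> region t \<and> region t \<subseteq> cball x R" if "congruent_copy t" for t
  proof -
    obtain e u c p where t: "frame e u" "t = move (pose e u c) (prototile p)"
      using \<open>congruent_copy t\<close> unfolding congruent_copy_iff by blast
    have "\<exists>x. ball x (1/10) \<subseteq> region (prototile p)"
      using ball_proto_triangle ball_proto_rhombus by (cases p) blast+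
    then obtain x where x: "ball x (1/10) \<subseteq> region (prototile p)"
      by blast
    then have "x \<in> region (prototile p)"
      by auto
    have d: "dist (pose e u c z) (pose e u c w) = dist z w" for z w
      using isometry_pose[OF t(1)] by (simp add: isometry_def)
    obtain u' c' where inv: "pose e u c \<circ> pose e u' c' = id"
      using pose_inverse[OF t(1)] by blast
    have "w \<in> region t" if "w \<in> ball (pose e u c x) (1/10)" for w
    proof -
      have w: "pose e u c (pose e u' c' w) = w"
        using inv by (metis comp_apply id_apply)
      then have "pose e u' c' w \<in> ball x (1/10)"
        using that d[of x "pose e u' c' w"] by simp
      then show ?thesis
        using x w unfolding t(2) region_move by (metis image_eqI subsetD)
    qed
    moreover have "dist (pose e u c x) w \<le> R" if w: "w \<in> region t" for w
    proof -
      obtain z where "z \<in> region (prototile p)" "w = pose e u c z"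
        using w by (auto simp: t(2) region_move)
      then show ?thesis
        using R[of x z] \<open>x \<in> region (prototile p)\<close> d by (cases p) auto
    qed
    ultimately show ?thesis
      by (intro exI[of _ "pose e u c x"]) auto
  qed
  then show thesis
    using that[of "1/10" R] by simp
qed

text \<open>Each tile contains a ball of radius \<open>r\<close> about \<open>x t\<close>, and
  interiors are disjoint, so the points \<open>x t\<close> keep distance at least \<open>r\<close>.
  For tiles that meet the given ball they form a bounded set, which is therefore finite.\<close>

lemma tiling_locally_finite:
  assumes "tiling T"
  shows "finite {t \<in> T. region t \<inter> cball x0 \<rho> \<noteq> {}}"
proof -
  obtain r R where r: "0 < r" and "\<And>t. congruent_copy t \<Longrightarrow> \<exists>x. ball x r \<subseteq> region t \<and> region t \<subseteq> cball x R"
    using tile_size by blast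
  then obtain x where x: "\<And>t. congruent_copy t \<Longrightarrow> ball (x t) r \<subseteq> region t \<and> region t \<subseteq> cball (x t) R"
    by metis
  define G where "G = {t \<in> T. region t \<inter> cball x0 \<rho> \<noteq> {}}"
  have cc: "congruent_copy t" if "t \<in> G" for t
    using assms that by (auto simp: tiling_def G_def)
  have far: "s = t" if "s \<in> G" "t \<in> G" "dist (x s) (x t) < r" for s t
  proof (rule ccontr)
    assume "s \<noteq> t"
    moreover have "ball (x s) r \<subseteq> interior (region s)" "ball (x t) r \<subseteq> interior (region t)"
      using x cc that(1,2) by (simp_all add: interior_maximal)
    moreover have "x t \<in> ball (x s) r" "x t \<in> ball (x t) r"
      using that(3) r by simp_all
    ultimately show False
      using assms that(1,2) unfolding tiling_def G_def by blast
  qed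
  have "uniform_discrete (x ` G)"
    unfolding uniform_discrete_def using r far by (intro exI[of _ r]) auto
  moreover have "bounded (x ` G)"
  proof (rule boundedI)
    fix y assume "y \<in> x ` G"
    then obtain t where "t \<in> G" "y = x t"
      by blast
    moreover from this obtain z where "z \<in> region t" "z \<in> cball x0 \<rho>"
      unfolding G_def by blast
    ultimately have t: "t \<in> G" "y = x t" "z \<in> region t" "z \<in> cball x0 \<rho>"
      by blast+
    have "dist y z \<le> R"
      using x[OF cc[OF t(1)]] t by auto
    then show "norm y \<le> norm x0 + \<rho> + R"
      using t(4) norm_triangle_ineq2[of y x0] dist_triangle[of y x0 z]
      by (simp add: dist_norm norm_minus_commute)
  qed
  ultimately have "finite (x ` G)"
    by (meson compact_eq_bounded_closed discrete_compact_finite_iff uniform_discrete_imp_closed uniform_discrete_imp_discrete)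
  moreover have "inj_on x G"
    using far r by (intro inj_onI) auto
  ultimately show ?thesis
    using finite_imageD unfolding G_def by blast
qed

lemma has_edge_segment_subset:
  assumes "has_edge t a b s"
  shows "closed_segment a b \<subseteq> region t"
  using assms
proof (cases rule: has_edge_cases)
  case (1 u c p a0 b0)
  have "a0 \<in> region (prototile p) \<and> b0 \<in> region (prototile p)"
    using 1(2) by (cases p) (auto simp: Let_def region_triangle region_rhombus zero_complex.ctr one_complex.ctr intro: hull_inc)
  then have "a \<in> region t" "b \<in> region t"
    by (simp_all add: 1 region_move)
  moreover have "convex (region t)"
    using 1(1,3) congruent_copy_iff by (intro region_congruent_copy) blast
  ultimately show ?thesis
    by (rule closed_segment_subset)
qed

text \<open>A closed convex tile with nonempty interior is the closure of that interior, so the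
  interior of one tile misses all of the other. The convex intersection thus lies in both
  frontiers.\<close>

lemma share_segmentI:
  assumes "congruent_copy s" "congruent_copy t" "interior (region s) \<inter> interior (region t) = {}"
    and "x \<in> region s \<inter> region t" "y \<in> region s \<inter> region t" "x \<noteq> y"
  shows "share_segment s t"
proof -
  have *: "region s \<inter> region t \<subseteq> frontier (region s)"
    if s: "congruent_copy s" and t: "congruent_copy t" and "interior (region s) \<inter> interior (region t) = {}" for s t
  proof -
    obtain r x where r: "0 < r" "ball x r \<subseteq> region t"
      using tile_size t by metis
    then have "interior (region t) \<noteq> {}"
      using interior_maximal[OF r(2)] by auto
    then have "closure (interior (region t)) = region t"
      using convex_closure_interior[OF region_congruent_copy(1)[OF t]] region_congruent_copy(2)[OF t]
      by (simp add: compact_imp_closed closure_closed)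
    then have "interior (region s) \<inter> region t = {}"
      using that(3) open_Int_closure_eq_empty[of "interior (region s)" "interior (region t)"] by simp
    then show ?thesis
      using closure_subset by (auto simp: frontier_def)
  qed
  have "closed_segment x y \<subseteq> region s \<inter> region t"
    using assms(4,5) convex_Int[OF region_congruent_copy(1)[OF assms(1)] region_congruent_copy(1)[OF assms(2)]]
    by (rule closed_segment_subset)
  moreover have "region s \<inter> region t \<subseteq> frontier (region s)" "region t \<inter> region s \<subseteq> frontier (region t)"
    using *[OF assms(1,2,3)] *[OF assms(2,1)] assms(3) by (simp_all add: Int_commute)
  ultimately have "closed_segment x y \<subseteq> frontier (region s) \<inter> frontier (region t)"
    by blast
  then show ?thesis
    using assms(6) unfolding share_segment_def by blast
qed

text \<open>Points just outside an edge of \<open>s\<close> belong to other tiles, of which finitely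
  many come near. Their union is closed and so covers the edge; one of them must contain infinitely
  many of its points.\<close>

lemma tiling_has_neighbours:
  assumes "tiling T"
  obtains s t where "s \<in> T" "t \<in> T" "s \<noteq> t" "share_segment s t"
proof -
  have cc: "congruent_copy t" if "t \<in> T" for t
    using assms that by (simp add: tiling_def)
  obtain s where s: "s \<in> T"
    using assms by (auto simp: tiling_def)
  obtain e u c p where "frame e u" "s = move (pose e u c) (prototile p)"
    using cc[OF s] unfolding congruent_copy_iff by blast
  moreover obtain a0 b0 where "(a0, b0) \<in> proto_edges p"
    by (cases p) auto
  ultimately obtain a b k where e: "has_edge s a b k"
    using has_edge by metis
  have k: "k * k = 1" "\<bar>k\<bar> = 1"
    using has_edge_sign[OF e] by auto
  have ab: "a \<noteq> b" "norm (b - a) \<le> 2"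
    using has_edge_norm[OF e] sqrt_2_bounds by auto
  \<comment> \<open>Radius \<open>4\<close>: a point of the edge is within \<open>2\<close> of
    \<open>a\<close>, and the shift to \<open>w\<close> below has length at most
    \<open>2\<close>.\<close>
  define G where "G = {t \<in> T. region t \<inter> cball a 4 \<noteq> {}} - {s}"
  have "finite G"
    using tiling_locally_finite[OF assms] by (simp add: G_def)
  have "closed_segment a b \<subseteq> closure (\<Union>t\<in>G. region t)"
  proof
    fix z assume z: "z \<in> closed_segment a b"
    show "z \<in> closure (\<Union>t\<in>G. region t)"
      unfolding closure_approachable
    proof (intro allI impI)
      fix \<epsilon> :: real assume "0 < \<epsilon>"
      define d where "d = min 1 (\<epsilon> / 4)"
      have d: "0 < d" "d \<le> 1" "d * 2 < \<epsilon>"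
        using \<open>0 < \<epsilon>\<close> by (auto simp: d_def)
      \<comment> \<open>\<open>z\<close> pushed off the edge, away from \<open>s\<close>.\<close>
      define w where "w = z - (d * k) *\<^sub>R (\<i> * (b - a))"
      have dzw: "dist w z = d * norm (b - a)"
        using d k by (simp add: w_def dist_norm norm_mult abs_mult)
      have "k * side a b w = k * side a b z - d * (k * k) * (norm (b - a))\<^sup>2"
      proof -
        have "(\<i> * (b - a)) \<bullet> (\<i> * (b - a)) = (norm (b - a))\<^sup>2"
          unfolding power2_norm_eq_inner[symmetric] by (simp add: norm_mult)
        moreover have "w - a = (z - a) - (d * k) *\<^sub>R (\<i> * (b - a))"
          by (simp add: w_def)
        ultimately have "side a b w = side a b z - (d * k) * (norm (b - a))\<^sup>2"
          by (simp only: side_def inner_diff_right inner_scaleR_right)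
        then show ?thesis
          by (simp add: right_diff_distrib)
      qed
      also have "\<dots> < 0"
        using side_segment[OF z] d(1) ab(1) k(1) by simp
      finally have "w \<notin> region s"
        using has_edge_side[OF e, of w] side_segment[of w a b] by auto
      moreover obtain t where t: "t \<in> T" "w \<in> region t"
      proof -
        have "w \<in> (\<Union>t\<in>T. region t)"
          using assms by (simp add: tiling_def)
        then show thesis
          using that by blast
      qed
      moreover have "dist a w \<le> 4"
      proof -
        have "dist a z \<le> dist a b"
          using dist_in_closed_segment(1)[OF z] by (simp only: dist_commute)
        also have "\<dots> \<le> 2"
          using ab(2) by (simp add: dist_norm norm_minus_commute)
        finally have "dist a z \<le> 2" .
        moreover have "dist w z \<le> 1 * 2"
          unfolding dzw using d ab(2) by (intro mult_mono) auto
        ultimately show ?thesis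
          using dist_triangle[of a w z] by (simp add: dist_commute)
      qed
      ultimately have "t \<in> G"
        by (auto simp: G_def)
      moreover have "dist w z < \<epsilon>"
        using mult_left_mono[OF ab(2), of d] d unfolding dzw by linarith
      ultimately show "\<exists>y\<in>\<Union>t\<in>G. region t. dist y z < \<epsilon>"
        using t(2) by blast
    qed
  qed
  also have "closure (\<Union>t\<in>G. region t) = (\<Union>t\<in>G. region t)"
    using \<open>finite G\<close> cc region_congruent_copy(2)
    by (intro closure_closed closed_UN) (auto simp: G_def compact_imp_closed)
  finally have "closed_segment a b = (\<Union>t\<in>G. closed_segment a b \<inter> region t)"
    by auto
  moreover have "infinite (closed_segment a b)"
    using ab(1) by simp
  ultimately obtain t where t: "t \<in> G" "infinite (closed_segment a b \<inter> region t)"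
    using \<open>finite G\<close> by (metis finite_UN_I)
  then obtain x y where xy: "x \<in> closed_segment a b \<inter> region t" "y \<in> closed_segment a b \<inter> region t" "x \<noteq> y"
    by (metis finite.simps infinite_imp_nonempty insertI1 all_not_in_conv finite_subset subsetI singletonI)
  have t': "t \<in> T" "s \<noteq> t"
    using t(1) by (auto simp: G_def)
  have "share_segment s t"
  proof (rule share_segmentI[OF cc cc])
    show "interior (region s) \<inter> interior (region t) = {}"
      using assms s t' by (simp add: tiling_def)
  qed (use xy has_edge_segment_subset[OF e] s t' in auto)
  then show thesis
    using that s t' by blast
qed

section \<open>The colouring of the tiling\<close>

lemma share_segment_two_points:
  assumes "congruent_copy s" "congruent_copy t" "share_segment s t"
  obtains x y where "x \<in> region s \<inter> region t" "y \<in> region s \<inter> region t" "x \<noteq> y"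
proof -
  obtain x y where xy: "x \<noteq> y" "closed_segment x y \<subseteq> frontier (region s) \<inter> frontier (region t)"
    using assms(3) unfolding share_segment_def by blast
  then have "closed_segment x y \<subseteq> region s \<inter> region t"
    using assms(1,2) region_congruent_copy(2) compact_imp_closed frontier_subset_closed by blast
  then show thesis
    using that[of x y] xy(1) by auto
qed

text \<open>\<open>m\<close> is the factor \<open>e * u ^ 4\<close> of the isometry that places the
  supertile, so it may depend on \<open>F\<close>.\<close>

lemma ammann_beenker_finite_subset:
  assumes "ammann_beenker_tiling T" "F \<subseteq> T" "finite F"
  obtains m where "m \<noteq> 0" "\<And>t. t \<in> F \<Longrightarrow> has_colour t m \<or> has_colour t (- m)"
    "\<And>s t. s \<in> F \<Longrightarrow> t \<in> F \<Longrightarrow> s \<noteq> t \<Longrightarrow> compatible s t"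
proof -
  obtain n p f where f: "isometry f" "F \<subseteq> move f ` ((subst ^^ n) {prototile p})"
    using assms unfolding ammann_beenker_tiling_def by blast
  obtain e u c where eu: "frame e u" "f = pose e u c"
    using isometry_is_pose[OF f(1)] .
  show thesis
  proof (rule that[of "e * u ^ 4"])
    show "complex_of_real e * u ^ 4 \<noteq> 0"
      using eu(1) by (auto simp: frame_def)
    show "has_colour t (e * u ^ 4) \<or> has_colour t (- (e * u ^ 4))" if "t \<in> F" for t
      using that f(2) patch_tiles has_colour_move_sign[OF eu(1)] unfolding eu(2) by blast
    show "compatible s t" if "s \<in> F" "t \<in> F" "s \<noteq> t" for s t
      using that f(2) patch_compatible compatible_move[OF eu(1)] unfolding eu(2) by blast
  qed
qed

text \<open>A translation is a pose with \<open>e = 1\<close> and \<open>u = 1\<close>, which acts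
  trivially on values.\<close>

lemma has_colour_translates:
  assumes "translates s t"
  shows "has_colour s k \<longleftrightarrow> has_colour t k"
proof -
  have *: "has_colour (move (\<lambda>x. x + v) s) k" if "has_colour s k" for v s
  proof -
    have "pose 1 1 v = (\<lambda>x. x + v)"
      by (simp add: fun_eq_iff pose_def)
    then show ?thesis
      using has_colour_move[of 1 1 s k v] that by (simp add: frame_def)
  qed
  obtain v where v: "t = move (\<lambda>x. x + v) s"
    using assms unfolding translates_def by blast
  have "s = move (\<lambda>x. x + - v) t"
    using move_id[of s] unfolding v move_move by (simp add: comp_def id_def)
  then show ?thesis
    using *[of s v] *[of t "- v"] v by auto
qed

theorem theorem4p3:
  fixes T :: "tile set"
  assumes "ammann_beenker_tiling T"
  shows "face_colourable T 2 \<and> (\<forall>k. face_colourable T k \<longrightarrow> 2 \<le> k) \<and>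
    (\<exists>c :: tile \<Rightarrow> nat. proper_face_colouring T c \<and> c ` T \<subseteq> {..<2} \<and>
       (\<forall>s\<in>T. \<forall>t\<in>T. translates s t \<longrightarrow> c s = c t))"
proof -
  have tiling: "tiling T"
    using assms by (simp add: ammann_beenker_tiling_def)
  then have cc: "congruent_copy t" if "t \<in> T" for t
    using that by (simp add: tiling_def)
  obtain t0 where "t0 \<in> T"
    using tiling_has_neighbours[OF tiling] by blast
  \<comment> \<open>The value of one reference tile serves for all of \<open>T\<close>.\<close>
  obtain m where m: "m \<noteq> 0" "has_colour t0 m"
  proof (rule ammann_beenker_finite_subset[OF assms, of "{t0}"])
    fix m assume "m \<noteq> 0" "\<And>t. t \<in> {t0} \<Longrightarrow> has_colour t m \<or> has_colour t (- m)"
    then show thesis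
      using that[of m] that[of "- m"] by auto
  qed (use \<open>t0 \<in> T\<close> in auto)
  \<comment> \<open>On \<open>T\<close> the only other value is \<open>- m\<close>, which the
    default colour \<open>1\<close> stands for.\<close>
  define c :: "tile \<Rightarrow> nat" where "c t = (if has_colour t m then 0 else 1)" for t
  have "c s \<noteq> c t" if st: "s \<in> T" "t \<in> T" "s \<noteq> t" "share_segment s t" for s t
  proof -
    \<comment> \<open>Including \<open>t0\<close> ties the value \<open>m'\<close> of this finite
      set to \<open>m\<close> up to sign.\<close>
    have sub: "{t0, s, t} \<subseteq> T" "finite {t0, s, t}"
      using st \<open>t0 \<in> T\<close> by auto
    obtain m' where m': "\<And>x. x \<in> {t0, s, t} \<Longrightarrow> has_colour x m' \<or> has_colour x (- m')"
      and "compatible s t"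
      by (rule ammann_beenker_finite_subset[OF assms sub]) (use st(3) in blast)
    have "m = m' \<or> m = - m'"
      using m'[of t0] has_colour_unique[OF m(2)] by blast
    then have pm: "has_colour s m \<or> has_colour s (- m)"
      using m'[of s] by auto
    obtain x y where "x \<in> region s \<inter> region t" "y \<in> region s \<inter> region t" "x \<noteq> y"
      using share_segment_two_points[OF cc cc] st by blast
    then obtain a b k where "has_edge s a b k" "has_edge t a b (- k)"
      using \<open>compatible s t\<close> unfolding compatible_def by blast
    then have col: "has_colour s (k * edge_colour (b - a))" "has_colour t (- (k * edge_colour (b - a)))"
      using has_colour_edge by fastforce+
    show ?thesis
    proof (cases "has_colour s m")
      case True
      then have "has_colour t (- m)"
        using col has_colour_unique by metis
      moreover have "m \<noteq> - m"
        using m(1) by (simp add: eq_neg_iff_add_eq_0 flip: mult_2)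
      ultimately have "\<not> has_colour t m"
        using has_colour_unique by blast
      then show ?thesis
        using True by (simp add: c_def)
    next
      case False
      then have "has_colour t m"
        using pm col has_colour_unique by (metis minus_minus)
      then show ?thesis
        using False by (simp add: c_def)
    qed
  qed
  then have proper: "proper_face_colouring T c"
    by (simp add: proper_face_colouring_def)
  have range: "c ` T \<subseteq> {..<2}"
    by (auto simp: c_def)
  have trans: "\<forall>s\<in>T. \<forall>t\<in>T. translates s t \<longrightarrow> c s = c t"
  proof (intro ballI impI)
    fix s t assume "translates s t"
    from has_colour_translates[OF this, of m] show "c s = c t"
      by (simp only: c_def)
  qed
  have "2 \<le> k" if k: "face_colourable T k" for k
  proof -
    obtain c' :: "tile \<Rightarrow> nat" where c': "proper_face_colouring T c'" "c' ` T \<subseteq> {..<k}"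
      using k unfolding face_colourable_def by blast
    obtain s t where st: "s \<in> T" "t \<in> T" "s \<noteq> t" "share_segment s t"
      using tiling_has_neighbours[OF tiling] .
    then have "c' s \<noteq> c' t" "c' s < k" "c' t < k"
      using c' unfolding proper_face_colouring_def by blast+
    then show ?thesis
      by linarith
  qed
  then show ?thesis
    using proper range trans unfolding face_colourable_def by blast
qed

end
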